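(* Assume $F=f+h$ is uniformly convex of degree $q$ with constant $\sigma_q>0$, where $2\le q\le p+1$, that $F$ attains its minimum $F^*$ at $x^*$, and consider the Regularized Composite Tensor Method $x_0\in\operatorname{dom}h$, $x_{k+1}=T_H(x_k)$, $k\ge0$, with $H=pL_p$. Let $D=\sup_{x\in\operatorname{dom}h}\{\|x-x^*\|:F(x)\le F(x_0)\}<+\infty$ and $$\omega_{p,q}=\frac{p+1}{p!}\Big(\frac{q-1}{q}\Big)^{q-1}\frac{L_pD^{p-q+1}}{\sigma_q}.$$ Then $$F(x_k)-F^*\le\exp\Big(-\frac{k}{1+\omega_{p,q}^{1/p}}\Big)\big(F(x_0)-F^*\big),\qquad k\ge1.$$ Consequently, for any $\varepsilon>0$, to achieve $F(x_K)-F^*\le\varepsilon$ it is enough to take $$K=\Big\lceil(1+\omega_{p,q}^{1/p})\log\frac{F(x_0)-F^*}{\varepsilon}\Big\rceil+1.$$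
   Context: $\mathbb{E}$ is a finite-dimensional real vector space with dual $\mathbb{E}^*$; $B:\mathbb{E}\to\mathbb{E}^*$ is a fixed self-adjoint positive-definite operator, $\|x\|=\langle Bx,x\rangle^{1/2}$, $\|g\|_*=\langle g,B^{-1}g\rangle^{1/2}$. Let $p\ge 2$ be an integer, $h:\mathbb{E}\to\mathbb{R}\cup\{+\infty\}$ proper closed convex, and $f$ convex and $p$ times differentiable on an open convex set containing $\operatorname{dom}h$, with $\|D^pf(x)-D^pf(y)\|\le L_p\|x-y\|$ for $x,y\in\operatorname{dom}h$, $0<L_p<\infty$, where for a symmetric $p$-linear form $\|A\|=\max_{\|u\|\le1}|A[u]^p|$. $F=f+h$. Taylor polynomial $\Omega_p(f,x;y)=f(x)+\sum_{k=1}^p\frac1{k!}D^kf(x)[y-x]^k$. For $x\in\operatorname{dom}h$, $T_H(x)=\arg\min_{y\in\mathbb{E}}\{\Omega_p(f,x;y)+\frac{H}{(p+1)!}\|y-x\|^{p+1}+h(y)\}$. Uniform convexity of degree $q$ with constant $\sigma_q$: $\langle G_x-G_y,x-y\rangle\ge\sigma_q\|x-y\|^q$ for all $x,y\in\operatorname{dom}h$, $G_x\in\partial F(x)$, $G_y\in\partial F(y)$. $\log$ is the natural logarithm. *)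

theory Defs
  imports "HOL-Analysis.Analysis"
begin

text \<open>The space E is modelled by a Euclidean space type 'a; the dual E* is identified
with 'a via the inner product, so the pairing of g with x is g \<bullet> x.  The operator
B : E \<rightarrow> E* becomes a linear map 'a \<Rightarrow> 'a.\<close>

definition selfadj_posdef :: "('a::euclidean_space \<Rightarrow> 'a) \<Rightarrow> bool" where
  "selfadj_posdef B \<longleftrightarrow> linear B \<and> (\<forall>x y. B x \<bullet> y = x \<bullet> B y) \<and> (\<forall>x. x \<noteq> 0 \<longrightarrow> B x \<bullet> x > 0)"

definition normB :: "('a::euclidean_space \<Rightarrow> 'a) \<Rightarrow> 'a \<Rightarrow> real" where
  "normB B x = sqrt (B x \<bullet> x)"

text \<open>Higher derivatives: Df k x [u1,...,uk] = D^k f(x)[u1,...,uk].  The k+1-st derivative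
is the Frechet derivative (at every point of S) of the k-th one in each fixed argument list.\<close>

definition has_derivs ::
  "('a::euclidean_space \<Rightarrow> real) \<Rightarrow> (nat \<Rightarrow> 'a \<Rightarrow> 'a list \<Rightarrow> real) \<Rightarrow> nat \<Rightarrow> 'a set \<Rightarrow> bool" where
  "has_derivs f Df p S \<longleftrightarrow>
     (\<forall>x\<in>S. Df 0 x [] = f x) \<and>
     (\<forall>k<p. \<forall>us. length us = k \<longrightarrow>
        (\<forall>x\<in>S. ((\<lambda>z. Df k z us) has_derivative (\<lambda>v. Df (Suc k) x (v # us))) (at x)))"

definition form_norm :: "('a::euclidean_space \<Rightarrow> 'a) \<Rightarrow> nat \<Rightarrow> ('a list \<Rightarrow> real) \<Rightarrow> real" where
  "form_norm B p A = Sup {\<bar>A (replicate p u)\<bar> | u. normB B u \<le> 1}"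

definition taylor :: "('a::euclidean_space \<Rightarrow> real) \<Rightarrow> (nat \<Rightarrow> 'a \<Rightarrow> 'a list \<Rightarrow> real) \<Rightarrow> nat \<Rightarrow> 'a \<Rightarrow> 'a \<Rightarrow> real" where
  "taylor f Df p x y = f x + (\<Sum>k=1..p. Df k x (replicate k (y - x)) / fact k)"

text \<open>Proper closed convex h: E \<rightarrow> R \<union> {+\<infinity>} is represented by its (nonempty) effective
domain Dh and its finite values on Dh.\<close>

definition proper_closed_convex :: "'a::euclidean_space set \<Rightarrow> ('a \<Rightarrow> real) \<Rightarrow> bool" where
  "proper_closed_convex Dh h \<longleftrightarrow> Dh \<noteq> {} \<and> convex Dh \<and> convex_on Dh h \<and>
     closed {(x, t). x \<in> Dh \<and> h x \<le> t}"

definition subdiff :: "'a::euclidean_space set \<Rightarrow> ('a \<Rightarrow> real) \<Rightarrow> 'a \<Rightarrow> 'a set" where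
  "subdiff Dh F x = {G. \<forall>y\<in>Dh. F y \<ge> F x + G \<bullet> (y - x)}"

definition unif_convex :: "'a::euclidean_space set \<Rightarrow> ('a \<Rightarrow> real) \<Rightarrow> ('a \<Rightarrow> 'a) \<Rightarrow> real \<Rightarrow> real \<Rightarrow> bool" where
  "unif_convex Dh F B q \<sigma> \<longleftrightarrow> (\<forall>x\<in>Dh. \<forall>y\<in>Dh. \<forall>Gx\<in>subdiff Dh F x. \<forall>Gy\<in>subdiff Dh F y.
      (Gx - Gy) \<bullet> (x - y) \<ge> \<sigma> * normB B (x - y) powr q)"

text \<open>y is a point of T_H(x): a minimizer of the regularized model over dom h (= over E,
since the objective is +\<infinity> outside dom h).\<close>

definition is_TH :: "('a::euclidean_space \<Rightarrow> 'a) \<Rightarrow> ('a \<Rightarrow> real) \<Rightarrow> (nat \<Rightarrow> 'a \<Rightarrow> 'a list \<Rightarrow> real)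
     \<Rightarrow> nat \<Rightarrow> 'a set \<Rightarrow> ('a \<Rightarrow> real) \<Rightarrow> real \<Rightarrow> 'a \<Rightarrow> 'a \<Rightarrow> bool" where
  "is_TH B f Df p Dh h H x y \<longleftrightarrow> y \<in> Dh \<and>
     (\<forall>z\<in>Dh. taylor f Df p x y + H / fact (p+1) * normB B (y - x) ^ (p+1) + h y
              \<le> taylor f Df p x z + H / fact (p+1) * normB B (z - x) ^ (p+1) + h z)"

end

theory Submission
  imports Defs
begin

text \<open>Write T for the next iterate, r for the length of the step from x to T, and let g = B w be the
subgradient of F at T supplied by the optimality condition of the model.  The Taylor bound for the
gradient says that g + (p L / p!) r^(p-1) B (T - x) has dual norm at most (L / p!) r^p.  Squaring this
and eliminating r by Young's inequality gives
(F(x) - F(T))^p \<ge> (g \<bullet> (x - T))^p \<ge> p! / ((p+1) L) |g|^(p+1).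
On the other hand F(T) - F* is at most |g| D, and by uniform convexity at most
(q-1)/q \<sigma>^(-1/(q-1)) |g|^(q/(q-1)).  Interpolating the two bounds yields
F(T) - F* \<le> \<omega>^(1/p) (F(x) - F(T)), which is the linear rate.

The Lipschitz condition only controls the diagonal of D^p f, while the gradient bound needs values with
one different argument; that they have the same norm is Banach's theorem on symmetric forms over a
Euclidean space.\<close>


text \<open>Uniform convexity speaks only about pairs of subgradients, and a point of dom h may have
  none, so the growth of F between T and the minimiser cannot be found by integrating along that
  segment. The integration runs in the dual space instead, along s B w for s in [0,1], where
  minimisers of F - s (B w, .) supply points at which s B w is a subgradient. Their existence for s
  < 1 rests on closed epigraphs and bounded sublevel sets, and the latter come from the finiteness
  of D. At s = 1 the point T itself serves; at s = 0 the value is F*.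

  The choice H = p L makes the coefficient of B (T - x) equal to p times the one in the Taylor
  bound. After squaring, the pure powers of r combine to (p^2 - 1) (L / p!)^2 r^(2p), and Young's
  inequality with weights (p+1)/(2p) and (p-1)/(2p) removes r altogether. In the interpolation the
  two bounds are raised to the powers p-q+1 and q-1, because the exponents of |g| then add up to
  (p-q+1) + q = p+1, the exponent delivered by the step.\<close>

section \<open>Geometry of the norm induced by B\<close>

context
  fixes B :: "'a::euclidean_space \<Rightarrow> 'a"
  assumes B: "selfadj_posdef B"
begin

lemma linB: "linear B"
  using B by (simp add: selfadj_posdef_def)

lemma B_sym: "B x \<bullet> y = B y \<bullet> x"
  using B by (metis selfadj_posdef_def inner_commute)

lemma B_pos: "x \<noteq> 0 \<Longrightarrow> B x \<bullet> x > 0"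
  using B unfolding selfadj_posdef_def by blast

lemma B_nonneg: "B x \<bullet> x \<ge> 0"
  using B_pos[of x] linB by (cases "x = 0") (auto simp: linear_0 less_imp_le)

lemmas B_simps = linear_add[OF linB] linear_diff[OF linB] linear_scale[OF linB] linear_0[OF linB]
  inner_add_left inner_add_right inner_diff_left inner_diff_right linear_neg[OF linB]

lemma normB_sq: "(normB B x)\<^sup>2 = B x \<bullet> x"
  by (simp add: normB_def B_nonneg)

lemma normB_nonneg [simp]: "normB B x \<ge> 0"
  by (simp add: normB_def B_nonneg)

lemma normB_zero [simp]: "normB B 0 = 0"
  by (simp add: normB_def B_simps)

lemma normB_eq_0_iff [simp]: "normB B x = 0 \<longleftrightarrow> x = 0"
  by (metis B_pos inner_zero_right less_irrefl normB_sq zero_power2 normB_zero)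

lemma normB_scaleR: "normB B (c *\<^sub>R x) = \<bar>c\<bar> * normB B x"
proof (rule power2_eq_imp_eq)
  show "(normB B (c *\<^sub>R x))\<^sup>2 = (\<bar>c\<bar> * normB B x)\<^sup>2"
    unfolding normB_sq power_mult_distrib by (simp add: B_simps power2_eq_square)
qed auto

lemma normB_minus: "normB B (x - y) = normB B (y - x)"
  using normB_scaleR[of "-1" "x - y"] by simp

lemma normB_add_sq: "(normB B (x + y))\<^sup>2 = (normB B x)\<^sup>2 + 2 * (B x \<bullet> y) + (normB B y)\<^sup>2"
  using B_sym[of x y] by (simp add: normB_sq B_simps)

lemma B_Cauchy_Schwarz: "B x \<bullet> y \<le> normB B x * normB B y"
proof (cases "x = 0 \<or> y = 0")
  case False
  let ?a = "normB B x" and ?b = "normB B y"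
  have pos: "?a > 0" "?b > 0"
    using False normB_nonneg[of x] normB_nonneg[of y] normB_eq_0_iff by (simp_all add: less_le)
  \<comment> \<open>With the norms crossed, both squares become
    \<open>?a\<^sup>2 * ?b\<^sup>2\<close>, so the expansion has the factor
    \<open>?a * ?b - B x \<bullet> y\<close>.\<close>
  have "0 \<le> (normB B (?b *\<^sub>R x + (- ?a) *\<^sub>R y))\<^sup>2"
    by simp
  also have "\<dots> = 2 * ?a * ?b * (?a * ?b - B x \<bullet> y)"
    unfolding normB_add_sq normB_scaleR by (simp add: B_simps power2_eq_square algebra_simps)
  finally show ?thesis
    using mult_pos_pos[OF pos] pos by (auto simp: zero_le_mult_iff)
qed (auto simp: B_simps)

lemma continuous_on_normB [continuous_intros]:
  assumes g: "continuous_on X g"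
  shows "continuous_on X (\<lambda>t. normB B (g t))"
proof -
  have "bounded_linear B" using linB linear_conv_bounded_linear by blast
  from bounded_linear.continuous_on[OF this g] show ?thesis
    unfolding normB_def using g by (intro continuous_intros)
qed

text \<open>The minimum of \<open>normB B\<close> on the Euclidean unit sphere is positive by
  compactness. This half of the norm equivalence makes balls and spheres of the B-norm bounded,
  hence compact.\<close>

lemma normB_ge_norm: obtains m where "m > 0" "\<And>x. m * norm x \<le> normB B x"
proof -
  obtain b :: 'a where b: "b \<in> Basis" by (meson nonempty_Basis ex_in_conv)
  have "compact (sphere (0::'a) 1)" "sphere (0::'a) 1 \<noteq> {}"
    using b by auto
  then obtain z where z: "z \<in> sphere 0 1" "\<forall>y\<in>sphere 0 1. normB B z \<le> normB B y"
    using continuous_attains_inf[of "sphere 0 1" "normB B"]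
      continuous_on_normB[OF continuous_on_id] by auto
  have "z \<noteq> 0" using z(1) by auto
  show ?thesis
  proof (rule that)
    show "normB B z > 0"
      using \<open>z \<noteq> 0\<close> normB_nonneg[of z] by (simp add: less_le del: normB_nonneg)
    show "normB B z * norm x \<le> normB B x" for x
    proof (cases "x = 0")
      case False
      then have "normB B z \<le> normB B ((1 / norm x) *\<^sub>R x)"
        using z(2) by (auto simp: dist_norm)
      then show ?thesis
        using False by (simp add: normB_scaleR field_simps)
    qed simp
  qed
qed

lemma bounded_normB_ball: "bounded {x. normB B x \<le> r}"
proof -
  obtain m where m: "m > 0" "\<And>x. m * norm x \<le> normB B x" using normB_ge_norm by blast
  have "norm x \<le> r / m" if "normB B x \<le> r" for x
    using m(1) m(2)[of x] that by (simp add: field_simps)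
  then show ?thesis by (auto simp: bounded_iff)
qed

lemma compact_normB_sphere: "compact {x. normB B x = 1}"
proof -
  have "closed {x. normB B x = 1}"
    by (intro closed_Collect_eq continuous_intros)
  moreover have "bounded {x. normB B x = 1}"
    by (rule bounded_subset[OF bounded_normB_ball[of 1]]) auto
  ultimately show ?thesis by (simp add: compact_eq_bounded_closed)
qed

lemma compact_normB_ball: "compact {x. normB B x \<le> r}"
proof -
  have "closed {x. normB B x \<le> r}"
    by (intro closed_Collect_le continuous_intros)
  then show ?thesis using bounded_normB_ball[of r] by (simp add: compact_eq_bounded_closed)
qed

text \<open>B is injective, so in finite dimension it is onto. Writing every functional as B w makes
  \<open>normB B w\<close> its dual norm, and the inverse of B never has to be named.\<close>

lemma dual_representation:
  assumes "linear l" obtains w where "\<And>v. l v = B w \<bullet> v"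
proof -
  have "inj B"
  proof (rule injI)
    fix x y assume "B x = B y"
    then have "B (x - y) \<bullet> (x - y) = 0" by (simp add: B_simps)
    then show "x = y" using B_pos[of "x - y"] by force
  qed
  then have "surj B" using linB linear_injective_imp_surjective by blast
  then obtain w where w: "B w = (\<Sum>b\<in>Basis. l b *\<^sub>R b)" by (metis surjD)
  have "l v = B w \<bullet> v" for v
  proof -
    have "l v = l (\<Sum>b\<in>Basis. (v \<bullet> b) *\<^sub>R b)" by (simp add: euclidean_representation)
    also have "\<dots> = (\<Sum>b\<in>Basis. l b * (b \<bullet> v))"
      using assms by (simp add: linear_sum linear_scale inner_commute mult.commute)
    finally show ?thesis by (simp add: w inner_sum_left)
  qed
  then show ?thesis using that by blast
qed

end

section \<open>Symmetric multilinear forms on argument lists\<close>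

definition multilinear_form :: "nat \<Rightarrow> ('a::euclidean_space list \<Rightarrow> real) \<Rightarrow> bool" where
  "multilinear_form n A \<longleftrightarrow>
     (\<forall>us vs. Suc (length us + length vs) = n \<longrightarrow> linear (\<lambda>v. A (us @ v # vs)))"

text \<open>Swaps of neighbours generate all permutations. Restricting to a fixed length n lets the
  property pass to the form obtained by fixing the first argument.\<close>

definition symmetric_form :: "nat \<Rightarrow> ('a list \<Rightarrow> real) \<Rightarrow> bool" where
  "symmetric_form n A \<longleftrightarrow>
     (\<forall>us a b vs. length us + length vs + 2 = n \<longrightarrow> A (us @ a # b # vs) = A (us @ b # a # vs))"

lemma multilinear_form_Cons:
  fixes A :: "'a::euclidean_space list \<Rightarrow> real"
  assumes "multilinear_form (Suc n) A"
  shows "multilinear_form n (\<lambda>us. A (u # us))"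
  unfolding multilinear_form_def
proof (intro allI impI)
  fix us vs :: "'a list" assume "Suc (length us + length vs) = n"
  then show "linear (\<lambda>v. A (u # us @ v # vs))"
    using assms[unfolded multilinear_form_def, rule_format, of "u # us" vs] by simp
qed

lemma symmetric_form_Cons:
  fixes A :: "'a list \<Rightarrow> real"
  assumes "symmetric_form (Suc n) A"
  shows "symmetric_form n (\<lambda>us. A (u # us))"
  unfolding symmetric_form_def
proof (intro allI impI)
  fix us vs :: "'a list" and a b assume "length us + length vs + 2 = n"
  then show "A (u # us @ a # b # vs) = A (u # us @ b # a # vs)"
    using assms[unfolded symmetric_form_def, rule_format, of "u # us" vs a b] by simp
qed

lemma multilinear_form_linear:
  assumes "multilinear_form (Suc n) A" "length vs = n"
  shows "linear (\<lambda>v. A (v # vs))"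
  using assms(1)[unfolded multilinear_form_def, rule_format, of "[]" vs] assms(2) by simp

lemma symmetric_form_swap:
  assumes "symmetric_form (Suc (Suc n)) A" "length vs = n"
  shows "A (a # b # vs) = A (b # a # vs)"
  using assms(1)[unfolded symmetric_form_def, rule_format, of "[]" vs a b] assms(2) by simp

text \<open>Expanding the first argument in the basis leaves continuous coordinates times forms of
  lower degree in the remaining arguments. The arguments are a list of functions so that this
  expansion drives an induction on the list.\<close>

lemma continuous_on_multilinear_form:
  fixes A :: "'a::euclidean_space list \<Rightarrow> real"
  assumes "multilinear_form (length fs) A" "\<And>f. f \<in> set fs \<Longrightarrow> continuous_on X f"
  shows "continuous_on X (\<lambda>t. A (map (\<lambda>f. f t) fs))"
  using assms
proof (induction fs arbitrary: A)
  case (Cons f fs)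
  have lin: "linear (\<lambda>v. A (v # map (\<lambda>f. f t) fs))" for t
    by (rule multilinear_form_linear) (use Cons.prems in auto)
  have eq: "A (map (\<lambda>f. f t) (f # fs)) = (\<Sum>b\<in>Basis. (f t \<bullet> b) * A (b # map (\<lambda>f. f t) fs))" for t
  proof -
    have "A (map (\<lambda>f. f t) (f # fs)) = A ((\<Sum>b\<in>Basis. (f t \<bullet> b) *\<^sub>R b) # map (\<lambda>f. f t) fs)"
      by (simp add: euclidean_representation)
    also have "\<dots> = (\<Sum>b\<in>Basis. A (((f t \<bullet> b) *\<^sub>R b) # map (\<lambda>f. f t) fs))"
      by (rule linear_sum[OF lin])
    also have "\<dots> = (\<Sum>b\<in>Basis. (f t \<bullet> b) * A (b # map (\<lambda>f. f t) fs))"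
      using linear_scale[OF lin] by (intro sum.cong) auto
    finally show ?thesis .
  qed
  have "continuous_on X (\<lambda>t. A (b # map (\<lambda>f. f t) fs))" for b
    by (rule Cons.IH) (use Cons.prems multilinear_form_Cons in auto)
  then show ?case
    unfolding eq using Cons.prems by (intro continuous_intros) auto
qed simp

section \<open>Banach's theorem: a symmetric form has its norm on the diagonal\<close>

context
  fixes B :: "'a::euclidean_space \<Rightarrow> 'a"
  assumes B: "selfadj_posdef B"
begin

lemma linear_functional_bound_unit:
  fixes l :: "'a \<Rightarrow> real"
  assumes "linear l" "\<And>v. normB B v = 1 \<Longrightarrow> \<bar>l v\<bar> \<le> c"
  shows "\<bar>l v\<bar> \<le> c * normB B v"
proof (cases "v = 0")
  case True
  then show ?thesis using assms(1) by (simp add: linear_0 normB_zero[OF B])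
next
  case False
  then have n: "normB B v > 0"
    using normB_nonneg[OF B, of v] normB_eq_0_iff[OF B, of v] by linarith
  then have "\<bar>l ((1 / normB B v) *\<^sub>R v)\<bar> \<le> c"
    by (intro assms(2)) (simp add: normB_scaleR[OF B])
  then show ?thesis
    using n by (simp add: linear_scale[OF assms(1)] abs_mult field_simps)
qed

text \<open>Equality case of Cauchy-Schwarz: the representer w has norm at most M and pairs with u
  to M, so the square of the norm of w - M u is at most M^2 - 2 M^2 + M^2 = 0.\<close>

lemma linear_functional_attains:
  fixes l :: "'a \<Rightarrow> real"
  assumes l: "linear l" "\<And>v. normB B v = 1 \<Longrightarrow> \<bar>l v\<bar> \<le> M"
    and u: "normB B u = 1" "l u = M" and "M > 0"
  shows "l x = M * (B u \<bullet> x)"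
proof -
  obtain w where w: "\<And>v. l v = B w \<bullet> v" using dual_representation[OF B l(1)] by blast
  have "(normB B w)\<^sup>2 \<le> M * normB B w"
    using linear_functional_bound_unit[OF l, of w] by (simp add: w normB_sq[OF B])
  then have le: "normB B w \<le> M"
    using normB_nonneg[OF B, of w] \<open>M > 0\<close>
    by (cases "normB B w = 0") (auto simp: power2_eq_square simp del: normB_eq_0_iff)
  have "(normB B (w + (- M) *\<^sub>R u))\<^sup>2 = (normB B w)\<^sup>2 - M\<^sup>2"
    unfolding normB_add_sq[OF B] normB_scaleR[OF B] using u w[of u]
    by (simp add: power2_eq_square)
  also have "\<dots> \<le> 0" using le normB_nonneg[OF B, of w] by (simp add: power_mono)
  finally have "w + (- M) *\<^sub>R u = 0" by (simp add: normB_eq_0_iff[OF B])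
  then have "w = M *\<^sub>R u" by simp
  then show ?thesis by (simp add: w B_simps[OF B])
qed

lemma normB_rotation:
  assumes "normB B v = 1" "normB B v' = 1" "B v \<bullet> v' = 0"
  shows "normB B (cos t *\<^sub>R v + sin t *\<^sub>R v') = 1"
proof -
  have "(normB B (cos t *\<^sub>R v + sin t *\<^sub>R v'))\<^sup>2 = 1"
    unfolding normB_add_sq[OF B] normB_scaleR[OF B] using assms
    by (simp add: power_mult_distrib B_simps[OF B])
  then show ?thesis
    using normB_nonneg[OF B, of "cos t *\<^sub>R v + sin t *\<^sub>R v'"] unfolding power2_eq_1_iff by linarith
qed

text \<open>In the plane of an orthonormal pair v, v', with e t = cos t v + sin t v',
the form is M times the cosine of the sum of the angles minus the angle of its maximiser; hence
the angle can be spread evenly over the arguments without leaving the maximal value M.\<close>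

lemma spread_angle:
  assumes "multilinear_form (Suc n) A" "symmetric_form (Suc n) A"
    and "\<And>us. length us = Suc n \<Longrightarrow> (\<And>u. u \<in> set us \<Longrightarrow> normB B u = 1) \<Longrightarrow> \<bar>A us\<bar> \<le> M"
    and v: "normB B v = 1" "normB B v' = 1" "B v \<bullet> v' = 0" and M: "M > 0"
    and e: "\<And>t. e t = cos t *\<^sub>R v + sin t *\<^sub>R v'"
    and th: "0 \<le> \<theta>" "\<theta> < pi"
    and att: "A (e \<theta> # replicate n v) = M"
  shows "A (replicate (Suc n) (e (\<theta> / Suc n))) = M"
  using assms(1-3) th att
proof (induction n arbitrary: A \<theta>)
  case (Suc n)
  let ?f = "\<lambda>a b. A (a # b # replicate n v)"
  have ev: "e 0 = v" by (simp add: e)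
  have e1: "normB B (e t) = 1" for t
    unfolding e by (rule normB_rotation[OF v])
  have lin1: "linear (\<lambda>a. ?f a b)" for b
    by (rule multilinear_form_linear[OF Suc.prems(1)]) simp
  have sym: "?f a b = ?f b a" for a b
    by (rule symmetric_form_swap[OF Suc.prems(2)]) simp
  have lin2: "linear (?f a)" for a
    using lin1[of a] sym[of _ a] by simp
  have bd: "\<bar>?f a b\<bar> \<le> M" if "normB B a = 1" "normB B b = 1" for a b
    by (rule Suc.prems(3)) (use that v in auto)
  \<comment> \<open>The share of the angle that the first argument receives. What is left, \<theta>
    - \<phi>, is \<phi> times the number of remaining arguments, so the induction hypothesis hands
    each of them \<phi> as well.\<close>
  define \<phi> where "\<phi> = \<theta> / Suc (Suc n)"
  have phi: "0 \<le> \<phi>" "\<theta> - \<phi> = \<phi> * Suc n" "0 \<le> \<theta> - \<phi>" "\<theta> - \<phi> < pi"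
  proof -
    show p: "0 \<le> \<phi>" using Suc.prems(4) by (simp add: \<phi>_def)
    show "\<theta> - \<phi> = \<phi> * Suc n" by (simp add: \<phi>_def field_simps)
    then show "0 \<le> \<theta> - \<phi>" using p by simp
    show "\<theta> - \<phi> < pi" using p Suc.prems(5) by simp
  qed
  have key: "?f (e \<phi>) (e (\<theta> - \<phi>)) = M"
  proof (cases "\<theta> = 0")
    case True
    then show ?thesis using Suc.prems(6) by (simp add: \<phi>_def ev)
  next
    case False
    then have s: "sin \<theta> \<noteq> 0" using Suc.prems(4,5) sin_gt_zero[of \<theta>] by force
    have uv: "?f (e \<theta>) v = M" "?f v (e \<theta>) = M" using Suc.prems(6) sym by auto
    \<comment> \<open>The functionals \<open>?f v\<close> and \<open>?f (e \<theta>)\<close> reach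
      the maximal value M at the unit vectors \<open>e \<theta>\<close> and \<open>v\<close>; the
      equality case determines both completely.\<close>
    have 1: "?f v x = M * (B (e \<theta>) \<bullet> x)" for x
      by (rule linear_functional_attains[OF lin2 bd]) (use v e1 uv M in auto)
    have 2: "?f (e \<theta>) x = M * (B v \<bullet> x)" for x
      by (rule linear_functional_attains[OF lin2 bd]) (use v e1 uv M in auto)
    have Bv: "B v \<bullet> v = 1" "B v' \<bullet> v' = 1" "B v' \<bullet> v = 0"
      using v normB_sq[OF B, of v] normB_sq[OF B, of v'] B_sym[OF B, of v v'] by auto
    have vv: "?f v v = M * cos \<theta>" and vw: "?f v v' = M * sin \<theta>"
      using 1 Bv v by (simp_all add: e B_simps[OF B])
    have expand: "?f (e s) b = cos s * ?f v b + sin s * ?f v' b" for s b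
      unfolding e using linear_add[OF lin1] linear_scale[OF lin1] by simp
    have expand2: "?f a (e s) = cos s * ?f a v + sin s * ?f a v'" for s a
      unfolding e using linear_add[OF lin2] linear_scale[OF lin2] by simp
    \<comment> \<open>The value at (v', v') comes from computing \<open>?f (e \<theta>) v'\<close>
      in two ways. Solving for it divides by sin \<theta>, which is why \<theta> = 0 is treated
      apart and \<theta> < pi is assumed.\<close>
    have "cos \<theta> * (M * sin \<theta>) + sin \<theta> * ?f v' v' = 0"
      using expand[of \<theta> v'] 2[of v'] v(3) vw by simp
    then have ww: "?f v' v' = - M * cos \<theta>"
      using s by (auto simp: algebra_simps) (metis add_eq_0_iff mult_left_cancel mult_minus_right mult.left_commute mult.commute)
    \<comment> \<open>In the plane of v and v' the form is
      \<open>?f (e s) (e t) = M * cos (s + t - \<theta>)\<close>, so only the sum of the two angles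
      matters.\<close>
    have "?f (e \<phi>) (e (\<theta> - \<phi>)) = M * (cos \<theta> * cos (\<phi> + (\<theta> - \<phi>)) + sin \<theta> * sin (\<phi> + (\<theta> - \<phi>)))"
      unfolding expand expand2 vv vw ww sym[of v' v] cos_add sin_add
      by (simp add: algebra_simps)
    also have "\<dots> = M * ((cos \<theta>)\<^sup>2 + (sin \<theta>)\<^sup>2)" by (simp add: power2_eq_square)
    finally show ?thesis by simp
  qed
  have "A (e \<phi> # replicate (Suc n) (e ((\<theta> - \<phi>) / Suc n))) = M"
  proof (rule Suc.IH)
    show "\<bar>A (e \<phi> # us)\<bar> \<le> M" if "length us = Suc n" "\<And>u. u \<in> set us \<Longrightarrow> normB B u = 1" for us
      by (rule Suc.prems(3)) (use that e1 in auto)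
  qed (use Suc.prems(1,2) phi key multilinear_form_Cons symmetric_form_Cons in auto)
  then show ?case using phi(2) by (simp add: \<phi>_def)
qed (simp add: e)

text \<open>With the first argument fixed, the induction hypothesis makes the others equal, so the
  maximum over unit arguments is found among lists u, v, ..., v, where compactness provides a
  maximiser. Spreading the angle between u and v evenly then moves the maximal value to the
  diagonal. The bound c is generalised because the induction hypothesis is applied with the maximum
  M in its place.\<close>

lemma norm_form_diagonal_unit:
  assumes "multilinear_form n A" "symmetric_form n A" "n > 0"
    and "\<And>u. normB B u = 1 \<Longrightarrow> \<bar>A (replicate n u)\<bar> \<le> c"
    and "length us = n" "\<And>u. u \<in> set us \<Longrightarrow> normB B u = 1"
  shows "\<bar>A us\<bar> \<le> c"
  using assms
proof (induction n arbitrary: A us c)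
  case (Suc n)
  show ?case
  proof (cases "n = 0")
    case True
    then obtain u where "us = [u]" using Suc.prems(5) by (cases us) auto
    then show ?thesis using Suc.prems(4)[of u] Suc.prems(6) True by simp
  next
    case False
    let ?S = "{x. normB B x = 1}"
    let ?g = "\<lambda>z. \<bar>A (fst z # replicate n (snd z))\<bar>"
    have "continuous_on (?S \<times> ?S) (\<lambda>z. A (map (\<lambda>f. f z) (fst # replicate n snd)))"
      by (rule continuous_on_multilinear_form) (use Suc.prems(1) in \<open>auto intro: continuous_intros\<close>)
    then have cont: "continuous_on (?S \<times> ?S) ?g"
      by (intro continuous_intros) simp
    obtain w where w: "w \<in> ?S"
      using Suc.prems(5,6) by (cases us) auto
    have "compact (?S \<times> ?S)" by (intro compact_Times compact_normB_sphere[OF B])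
    then obtain z where z: "z \<in> ?S \<times> ?S" "\<And>y. y \<in> ?S \<times> ?S \<Longrightarrow> ?g y \<le> ?g z"
      using continuous_attains_sup[OF _ _ cont] w by blast
    define M where "M = ?g z"
    obtain u v where uv: "z = (u, v)" "normB B u = 1" "normB B v = 1" using z(1) by (cases z) auto
    have bd: "\<bar>A us\<bar> \<le> M" if l: "length us = Suc n" "\<And>u. u \<in> set us \<Longrightarrow> normB B u = 1" for us
    proof -
      obtain x xs where us: "us = x # xs" using l(1) by (cases us) auto
      have "\<bar>A (x # xs)\<bar> \<le> M"
      proof (rule Suc.IH[of "\<lambda>us. A (x # us)"])
        show "\<bar>A (x # replicate n y)\<bar> \<le> M" if "normB B y = 1" for y
          using z(2)[of "(x, y)"] that l(2)[of x] us by (simp add: M_def)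
      qed (use Suc.prems(1,2) l us False multilinear_form_Cons symmetric_form_Cons in auto)
      then show ?thesis using us by simp
    qed
    \<comment> \<open>If u is v or its negative, the maximiser is already on the diagonal up to
      sign, and there is no plane in which to rotate.\<close>
    have "M \<le> c"
    proof (cases "M \<le> 0 \<or> (\<exists>s. \<bar>s\<bar> = 1 \<and> u = s *\<^sub>R v)")
      case True
      then show ?thesis
      proof
        assume "M \<le> 0"
        also have "0 \<le> \<bar>A (replicate (Suc n) w)\<bar>" by (rule abs_ge_zero)
        also have "\<dots> \<le> c" using Suc.prems(4) w by blast
        finally show ?thesis .
      next
        assume "\<exists>s. \<bar>s\<bar> = 1 \<and> u = s *\<^sub>R v"
        then obtain s where s: "\<bar>s\<bar> = 1" "u = s *\<^sub>R v" by blast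
        have "linear (\<lambda>a. A (a # replicate n v))"
          by (rule multilinear_form_linear[OF Suc.prems(1)]) simp
        then have "A (u # replicate n v) = s * A (v # replicate n v)"
          using linear_scale s(2) by fastforce
        then have "M = \<bar>A (replicate (Suc n) v)\<bar>" using s(1) by (simp add: M_def uv abs_mult)
        then show ?thesis using Suc.prems(4) uv(3) by simp
      qed
    next
      case False
      then have M: "M > 0" by auto
      define k where "k = B v \<bullet> u"
      define d where "d = normB B (u - k *\<^sub>R v)"
      have kk: "B u \<bullet> v = k" using B_sym[OF B] k_def by simp
      have d2: "d\<^sup>2 = 1 - k\<^sup>2"
        using normB_add_sq[OF B, of u "(-k) *\<^sub>R v"] uv kk normB_sq[OF B, of v]
          normB_scaleR[OF B, of "-k" v]
        by (simp add: d_def power2_eq_square)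
      have "d \<noteq> 0"
      proof
        assume "d = 0"
        then have "u = k *\<^sub>R v" "k\<^sup>2 = 1"
          using d2 by (simp_all add: normB_eq_0_iff[OF B] flip: d_def) (simp add: d_def normB_eq_0_iff[OF B])
        then show False using False by (metis abs_one abs_square_eq_1)
      qed
      then have d: "d > 0" using normB_nonneg[OF B] by (simp add: d_def less_le)
      have k1: "\<bar>k\<bar> < 1"
        using d2 zero_less_power[OF d, of 2] by (subst abs_square_less_1[symmetric]) linarith
      \<comment> \<open>Gram-Schmidt: v' completes v to an orthonormal pair of the plane of u and v,
        with u = cos \<theta> v + sin \<theta> v' for \<theta> = arccos k.\<close>
      define v' where "v' = (1 / d) *\<^sub>R (u - k *\<^sub>R v)"
      define \<theta> where "\<theta> = arccos k"
      define e where "e = (\<lambda>t. cos t *\<^sub>R v + sin t *\<^sub>R v')"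
      have th: "cos \<theta> = k" "sin \<theta> = d" "0 \<le> \<theta>" "\<theta> < pi"
      proof -
        show "cos \<theta> = k" "0 \<le> \<theta>" using k1 by (auto simp: \<theta>_def intro!: arccos_lbound)
        show "\<theta> < pi" using k1 arccos_lt_bounded[of k] by (auto simp: \<theta>_def)
        have "sin \<theta> = sqrt (d\<^sup>2)" using k1 d2 by (simp add: \<theta>_def sin_arccos_abs)
        then show "sin \<theta> = d" using d by simp
      qed
      have v': "normB B v' = 1" "B v \<bullet> v' = 0"
        using d uv(3) normB_sq[OF B, of v]
        by (auto simp: v'_def normB_scaleR[OF B] d_def[symmetric] B_simps[OF B] k_def[symmetric])
      have eu: "e \<theta> = u" using d by (simp add: e_def th v'_def)
      \<comment> \<open>The rotation argument starts from the value M itself, not from its absolute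
        value, so the form is multiplied by the sign of its extremal value.\<close>
      define sg where "sg = sgn (A (u # replicate n v))"
      have sg: "\<bar>sg\<bar> = 1" "sg * A (u # replicate n v) = M"
        using M uv(1) by (auto simp: sg_def M_def sgn_if)
      have "sg * A (replicate (Suc n) (e (\<theta> / Suc n))) = M"
      proof (rule spread_angle[where A = "\<lambda>us. sg * A us" and v = v and v' = v' and M = M and e = e])
        show "multilinear_form (Suc n) (\<lambda>us. sg * A us)"
          using Suc.prems(1) unfolding multilinear_form_def linear_iff by (auto simp: algebra_simps)
        show "symmetric_form (Suc n) (\<lambda>us. sg * A us)"
          using Suc.prems(2) by (auto simp: symmetric_form_def)
        show "\<bar>sg * A us\<bar> \<le> M" if "length us = Suc n" "\<And>u. u \<in> set us \<Longrightarrow> normB B u = 1" for us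
          using bd that sg(1) by (simp add: abs_mult)
      qed (use M uv v' th eu sg in \<open>auto simp: e_def\<close>)
      then have "M \<le> \<bar>A (replicate (Suc n) (e (\<theta> / Suc n)))\<bar>"
        using sg(1) by (metis abs_ge_self abs_mult mult_1)
      moreover have "normB B (e (\<theta> / Suc n)) = 1"
        unfolding e_def by (rule normB_rotation) (use uv v' in auto)
      ultimately show ?thesis using Suc.prems(4) by force
    qed
    then show ?thesis using bd Suc.prems(5,6) by force
  qed
qed simp

text \<open>Arguments are rescaled one at a time: the constant c absorbs the norm of the first
  argument before the induction hypothesis handles the rest.\<close>

lemma multilinear_form_bound_unit:
  assumes "multilinear_form n A"
    and "\<And>us. length us = n \<Longrightarrow> (\<And>u. u \<in> set us \<Longrightarrow> normB B u = 1) \<Longrightarrow> \<bar>A us\<bar> \<le> c"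
    and "length us = n"
  shows "\<bar>A us\<bar> \<le> c * prod_list (map (normB B) us)"
  using assms
proof (induction n arbitrary: A us c)
  case (Suc n)
  obtain x xs where us: "us = x # xs" using Suc.prems(3) by (cases us) auto
  have l: "length xs = n" using Suc.prems(3) us by simp
  have lin: "linear (\<lambda>v. A (v # ys))" if "length ys = n" for ys
    by (rule multilinear_form_linear[OF Suc.prems(1) that])
  have "\<bar>A (x # ys)\<bar> \<le> c * normB B x" if "length ys = n" "\<And>u. u \<in> set ys \<Longrightarrow> normB B u = 1" for ys
    by (rule linear_functional_bound_unit[OF lin[OF that(1)]], rule Suc.prems(2)) (use that in auto)
  then have "\<bar>A (x # xs)\<bar> \<le> (c * normB B x) * prod_list (map (normB B) xs)"
    using Suc.IH[OF multilinear_form_Cons[OF Suc.prems(1)], of x "c * normB B x" xs] l by blast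
  then show ?case by (simp add: us mult.assoc)
qed simp

lemma norm_form_diagonal:
  assumes "multilinear_form n A" "symmetric_form n A" "n > 0"
    and "\<And>u. normB B u = 1 \<Longrightarrow> \<bar>A (replicate n u)\<bar> \<le> c"
    and "length us = n"
  shows "\<bar>A us\<bar> \<le> c * prod_list (map (normB B) us)"
  using assms(1) norm_form_diagonal_unit[OF assms(1-4)] assms(5)
  by (intro multilinear_form_bound_unit) auto

end


section \<open>Linearity and symmetry of higher derivatives\<close>

lemma second_difference_limit:
  fixes g :: "'a::real_normed_vector \<Rightarrow> real"
  assumes S: "open S" "x \<in> S"
    and g: "\<And>z. z \<in> S \<Longrightarrow> (g has_derivative g' z) (at z)"
    and ga: "((\<lambda>z. g' z a) has_derivative ga) (at x)"
  shows "((\<lambda>t. (g (x + t *\<^sub>R a + t *\<^sub>R b) - g (x + t *\<^sub>R a) - g (x + t *\<^sub>R b) + g x) / t\<^sup>2)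
           \<longlongrightarrow> ga b) (at_right 0)"
proof (rule tendstoI)
  fix \<epsilon> :: real assume "\<epsilon> > 0"
  \<comment> \<open>The expansion is used at the displacements s a + t b and s a with 0 < s < t,
    whose lengths add up to at most t (2 |a| + |b|). The extra 1 keeps K positive.\<close>
  define K where "K = 2 * norm a + norm b + 1"
  define e where "e = \<epsilon> / (2 * K)"
  have K: "K > 0" unfolding K_def by (smt (verit) norm_ge_zero)
  then have e: "e > 0" using \<open>\<epsilon> > 0\<close> by (simp add: e_def)
  obtain r where r: "r > 0" "ball x r \<subseteq> S" using S by (meson open_contains_ball)
  obtain d where d: "d > 0" "\<And>y. norm (y - x) < d \<Longrightarrow>
      \<bar>g' y a - g' x a - ga (y - x)\<bar> \<le> e * norm (y - x)"
    using ga e unfolding has_derivative_at_alt by (metis real_norm_def)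
  have lin: "linear ga" using ga has_derivative_bounded_linear bounded_linear.linear by blast
  have main: "dist ((g (x + t *\<^sub>R a + t *\<^sub>R b) - g (x + t *\<^sub>R a) - g (x + t *\<^sub>R b) + g x) / t\<^sup>2) (ga b) < \<epsilon>"
    if t: "0 < t" "t < min r d / K" for t
  proof -
    have tK: "t * K < r" "t * K < d" using t(2) K by (simp_all add: field_simps)
    have nrm: "norm (s *\<^sub>R a + c *\<^sub>R b) \<le> t * (norm a + norm b)" "norm (s *\<^sub>R a + c *\<^sub>R b) < r"
      "norm (s *\<^sub>R a + c *\<^sub>R b) < d"
      if "0 \<le> s" "s \<le> t" "0 \<le> c" "c \<le> t" for s c
    proof -
      have "norm (s *\<^sub>R a + c *\<^sub>R b) \<le> s * norm a + c * norm b"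
        using norm_triangle_ineq[of "s *\<^sub>R a" "c *\<^sub>R b"] that by simp
      also have "\<dots> \<le> t * norm a + t * norm b"
        using that by (intro add_mono mult_right_mono) auto
      finally show 1: "norm (s *\<^sub>R a + c *\<^sub>R b) \<le> t * (norm a + norm b)" by (simp add: algebra_simps)
      have "t * (norm a + norm b) \<le> t * K" using t(1) by (simp add: K_def)
      then show "norm (s *\<^sub>R a + c *\<^sub>R b) < r" "norm (s *\<^sub>R a + c *\<^sub>R b) < d" using 1 tK by linarith+
    qed
    \<comment> \<open>Taking the increment along b as a function of the position along a means that
      only \<open>g'\<close> in direction a occurs, the partial derivative whose differentiability
      at x is assumed.\<close>
    define u where "u = (\<lambda>s. g (x + s *\<^sub>R a + t *\<^sub>R b) - g (x + s *\<^sub>R a))"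
    have line: "((\<lambda>s. g (x + s *\<^sub>R a + c *\<^sub>R b)) has_real_derivative g' (x + s *\<^sub>R a + c *\<^sub>R b) a) (at s)"
      if "0 \<le> s" "s \<le> t" "0 \<le> c" "c \<le> t" for s c
    proof -
      have "dist x (x + s *\<^sub>R a + c *\<^sub>R b) = norm (s *\<^sub>R a + c *\<^sub>R b)"
        by (metis add.assoc dist_add_cancel dist_0_norm add.right_neutral)
      then have "x + s *\<^sub>R a + c *\<^sub>R b \<in> S" using nrm(2)[OF that] r(2) by auto
      note D = g[OF this]
      have "((\<lambda>s. x + s *\<^sub>R a + c *\<^sub>R b) has_derivative (\<lambda>h. h *\<^sub>R a)) (at s)"
        by (auto intro!: derivative_eq_intros)
      from has_derivative_compose[OF this D]
      have "((\<lambda>s. g (x + s *\<^sub>R a + c *\<^sub>R b)) has_derivative (\<lambda>h. g' (x + s *\<^sub>R a + c *\<^sub>R b) (h *\<^sub>R a))) (at s)" .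
      moreover have "linear (g' (x + s *\<^sub>R a + c *\<^sub>R b))"
        using D has_derivative_bounded_linear bounded_linear.linear by blast
      ultimately show ?thesis
        by (simp add: has_field_derivative_def linear_scale mult_commute_abs)
    qed
    have "(u has_real_derivative g' (x + s *\<^sub>R a + t *\<^sub>R b) a - g' (x + s *\<^sub>R a) a) (at s)"
      if "0 \<le> s" "s \<le> t" for s
      using line[OF that, of t] line[OF that, of 0] t(1) unfolding u_def
      by (auto intro!: derivative_eq_intros)
    from MVT2[OF t(1) this] obtain s where s: "0 < s" "s < t"
      "u t - u 0 = t * (g' (x + s *\<^sub>R a + t *\<^sub>R b) a - g' (x + s *\<^sub>R a) a)" by auto
    define R where "R = (\<lambda>v. g' (x + v) a - g' x a - ga v)"
    have R: "\<bar>R (s *\<^sub>R a + c *\<^sub>R b)\<bar> \<le> e * norm (s *\<^sub>R a + c *\<^sub>R b)" if "0 \<le> c" "c \<le> t" for c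
      using d(2)[of "x + (s *\<^sub>R a + c *\<^sub>R b)"] nrm(3)[of s c] that s(1,2) by (simp add: R_def)
    have "u t - u 0 = t * (R (s *\<^sub>R a + t *\<^sub>R b) - R (s *\<^sub>R a + 0 *\<^sub>R b) + t * ga b)"
      using linear_add[OF lin] linear_scale[OF lin] unfolding s(3) R_def by (simp add: add.assoc)
    then have "(u t - u 0) - t\<^sup>2 * ga b = t * (R (s *\<^sub>R a + t *\<^sub>R b) - R (s *\<^sub>R a + 0 *\<^sub>R b))"
      by (simp add: algebra_simps power2_eq_square)
    then have "\<bar>(u t - u 0) - t\<^sup>2 * ga b\<bar> = t * \<bar>R (s *\<^sub>R a + t *\<^sub>R b) - R (s *\<^sub>R a + 0 *\<^sub>R b)\<bar>"
      using t(1) by (simp only: abs_mult abs_of_pos)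
    also have "\<dots> \<le> t * (e * (t * K))"
    proof -
      have "\<bar>R (s *\<^sub>R a + t *\<^sub>R b) - R (s *\<^sub>R a + 0 *\<^sub>R b)\<bar>
          \<le> e * norm (s *\<^sub>R a + t *\<^sub>R b) + e * norm (s *\<^sub>R a + 0 *\<^sub>R b)"
        using R[of t] R[of 0] t(1) by linarith
      also have "\<dots> \<le> e * (t * (norm a + norm b)) + e * (t * norm a)"
        using nrm(1)[of s t] s(1,2) t(1) e
        by (intro add_mono mult_left_mono) (auto intro!: mult_right_mono)
      also have "\<dots> \<le> e * (t * K)" using e t(1) by (simp add: K_def flip: distrib_left)
      finally show ?thesis using t(1) by simp
    qed
    finally have "\<bar>(u t - u 0) - t\<^sup>2 * ga b\<bar> \<le> t\<^sup>2 * (e * K)"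
      by (simp add: power2_eq_square mult_ac)
    then have "\<bar>(u t - u 0) / t\<^sup>2 - ga b\<bar> \<le> e * K"
    proof -
      assume h: "\<bar>(u t - u 0) - t\<^sup>2 * ga b\<bar> \<le> t\<^sup>2 * (e * K)"
      have "(u t - u 0) / t\<^sup>2 - ga b = ((u t - u 0) - t\<^sup>2 * ga b) / t\<^sup>2"
        using t(1) by (simp add: diff_divide_distrib)
      then have "\<bar>(u t - u 0) / t\<^sup>2 - ga b\<bar> = \<bar>(u t - u 0) - t\<^sup>2 * ga b\<bar> / t\<^sup>2" by simp
      also have "\<dots> \<le> e * K" using h t(1) by (simp add: divide_le_eq mult.commute)
      finally show ?thesis .
    qed
    also have "e * K < \<epsilon>" using K \<open>\<epsilon> > 0\<close> by (simp add: e_def)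
    finally show ?thesis by (simp add: u_def dist_real_def algebra_simps)
  qed
  have "min r d / K > 0" using r(1) d(1) K by simp
  then show "\<forall>\<^sub>F t in at_right 0. dist ((g (x + t *\<^sub>R a + t *\<^sub>R b) - g (x + t *\<^sub>R a)
      - g (x + t *\<^sub>R b) + g x) / t\<^sup>2) (ga b) < \<epsilon>"
    using main by (auto simp: eventually_at_right_field)
qed

lemma second_derivative_symmetric:
  fixes g :: "'a::real_normed_vector \<Rightarrow> real"
  assumes "open S" "x \<in> S"
    and "\<And>z. z \<in> S \<Longrightarrow> (g has_derivative g' z) (at z)"
    and "((\<lambda>z. g' z a) has_derivative ga) (at x)" "((\<lambda>z. g' z b) has_derivative gb) (at x)"
  shows "ga b = gb a"
proof (rule tendsto_unique)
  let ?q = "\<lambda>t. (g (x + t *\<^sub>R a + t *\<^sub>R b) - g (x + t *\<^sub>R a) - g (x + t *\<^sub>R b) + g x) / t\<^sup>2"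
  show "(?q \<longlongrightarrow> ga b) (at_right 0)"
    by (rule second_difference_limit[OF assms(1-4)])
  show "(?q \<longlongrightarrow> gb a) (at_right 0)"
    using second_difference_limit[OF assms(1-3,5), of a] by (simp add: algebra_simps)
qed simp

context
  fixes f :: "'a::euclidean_space \<Rightarrow> real" and Df p S
  assumes S: "open S" and fder: "has_derivs f Df p S"
begin

lemma has_derivs_at:
  "z \<in> S \<Longrightarrow> length us < p \<Longrightarrow>
    ((\<lambda>z. Df (length us) z us) has_derivative (\<lambda>v. Df (Suc (length us)) z (v # us))) (at z)"
  using fder by (auto simp: has_derivs_def)

text \<open>An identity for derivatives of one order that holds on the open set S can be
  differentiated. This is how linearity and symmetry climb from one order to the next.\<close>

lemma has_derivs_eqI:
  assumes "z \<in> S" "\<And>y. y \<in> S \<Longrightarrow> Df (length us) y us = g y" "length us < p"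
    and "(g has_derivative g') (at z)"
  shows "Df (Suc (length us)) z (v # us) = g' v"
proof -
  have "(g has_derivative (\<lambda>v. Df (Suc (length us)) z (v # us))) (at z)"
    by (rule has_derivative_transform_within_open[OF has_derivs_at[OF assms(1,3)] S assms(1,2)])
  from has_derivative_unique[OF this assms(4)] show ?thesis by metis
qed

text \<open>Linearity in the first slot belongs to the Frechet derivative. For a later slot, the
  prefix \<open>us\<close> lists the directions of the subsequent differentiations, and the
  linearity identity is differentiated along them.\<close>

lemma has_derivs_linear:
  "Suc (length us + length vs) \<le> p \<Longrightarrow> z \<in> S \<Longrightarrow>
     linear (\<lambda>v. Df (Suc (length us + length vs)) z (us @ v # vs))"
proof (induction us arbitrary: z)
  case Nil
  then show ?case
    using has_derivs_at[of z vs] has_derivative_bounded_linear bounded_linear.linear by fastforce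
next
  case (Cons u us)
  let ?n = "Suc (length us + length vs)"
  have lin: "linear (\<lambda>v. Df ?n y (us @ v # vs))" if "y \<in> S" for y
    using Cons that by simp
  have D: "((\<lambda>y. Df ?n y (us @ v # vs)) has_derivative (\<lambda>u. Df (Suc ?n) z (u # us @ v # vs))) (at z)" for v
    using has_derivs_at[of z "us @ v # vs"] Cons.prems by simp
  show ?case
  proof (rule linearI)
    fix v w
    show "Df (Suc (length (u # us) + length vs)) z ((u # us) @ (v + w) # vs) =
        Df (Suc (length (u # us) + length vs)) z ((u # us) @ v # vs) +
        Df (Suc (length (u # us) + length vs)) z ((u # us) @ w # vs)"
      using has_derivs_eqI[of z "us @ (v + w) # vs" _ _ u, OF _ _ _ has_derivative_add[OF D[of v] D[of w]]]
        Cons.prems linear_add[OF lin] by simp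
  next
    fix c v
    show "Df (Suc (length (u # us) + length vs)) z ((u # us) @ (c *\<^sub>R v) # vs) =
        c *\<^sub>R Df (Suc (length (u # us) + length vs)) z ((u # us) @ v # vs)"
      using has_derivs_eqI[of z "us @ (c *\<^sub>R v) # vs" _ _ u, OF _ _ _ has_derivative_scaleR_right[OF D[of v]]]
        Cons.prems linear_scale[OF lin] by simp
  qed
qed

lemma has_derivs_multilinear: "k \<le> p \<Longrightarrow> z \<in> S \<Longrightarrow> multilinear_form k (Df k z)"
  using has_derivs_linear by (auto simp: multilinear_form_def)

text \<open>Swapping the first two slots is the symmetry of second derivatives for the scalar
  function that has the trailing arguments frozen; a swap further back is a differentiated
  identity.\<close>

lemma has_derivs_swap:
  "length us + length vs + 2 \<le> p \<Longrightarrow> z \<in> S \<Longrightarrow>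
     Df (length us + length vs + 2) z (us @ a # b # vs) = Df (length us + length vs + 2) z (us @ b # a # vs)"
proof (induction us arbitrary: z)
  case Nil
  let ?n = "length vs"
  have D: "((\<lambda>z. Df (Suc ?n) z (b # vs)) has_derivative (\<lambda>a. Df (Suc (Suc ?n)) z (a # b # vs))) (at z)" for b
    using has_derivs_at[of z "b # vs"] Nil by simp
  have "(\<lambda>b. Df (Suc (Suc ?n)) z (b # a # vs)) b = (\<lambda>a. Df (Suc (Suc ?n)) z (a # b # vs)) a"
    by (rule second_derivative_symmetric[OF S Nil(2) has_derivs_at D D]) (use Nil in auto)
  then show ?case by simp
next
  case (Cons u us)
  have "Df (Suc (length (us @ a # b # vs))) z (u # us @ a # b # vs)
      = Df (Suc (length (us @ b # a # vs))) z (u # us @ b # a # vs)"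
    by (rule has_derivs_eqI[OF Cons.prems(2) _ _ has_derivs_at[OF Cons.prems(2)]])
      (use Cons in auto)
  then show ?case by simp
qed

lemma has_derivs_symmetric: "k \<le> p \<Longrightarrow> z \<in> S \<Longrightarrow> symmetric_form k (Df k z)"
  using has_derivs_swap by (fastforce simp: symmetric_form_def)

lemma has_derivs_line:
  assumes "x + t *\<^sub>R h \<in> S" "length us < p"
  shows "((\<lambda>t. Df (length us) (x + t *\<^sub>R h) us) has_real_derivative
           Df (Suc (length us)) (x + t *\<^sub>R h) (h # us)) (at t)"
proof -
  have "((\<lambda>s. x + s *\<^sub>R h) has_derivative (\<lambda>s. s *\<^sub>R h)) (at t)"
    by (auto intro!: derivative_eq_intros)
  from has_derivative_compose[OF this has_derivs_at[OF assms]]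
  have "((\<lambda>t. Df (length us) (x + t *\<^sub>R h) us) has_derivative
      (\<lambda>s. Df (Suc (length us)) (x + t *\<^sub>R h) ((s *\<^sub>R h) # us))) (at t)" .
  moreover have lin: "linear (\<lambda>v. Df (Suc (length us)) (x + t *\<^sub>R h) (v # us))"
    using has_derivs_linear[of "[]" us "x + t *\<^sub>R h"] assms by simp
  ultimately show ?thesis
    using linear_scale[OF lin] by (simp add: has_field_derivative_def mult_commute_abs)
qed

end

section \<open>Taylor bound for the gradient\<close>

text \<open>The highest derivative \<open>\<psi> n\<close> is only controlled by its distance from
  \<open>\<psi> n 0\<close>, so the remainder is integrated step by step: its derivative is the
  remainder of the shifted family \<open>\<lambda>k. \<psi> (Suc k)\<close>, to which the induction
  hypothesis applies.\<close>

lemma taylor_remainder_bound: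
  fixes \<psi> :: "nat \<Rightarrow> real \<Rightarrow> real"
  assumes "\<And>k t. k < n \<Longrightarrow> 0 \<le> t \<Longrightarrow> t \<le> 1 \<Longrightarrow> (\<psi> k has_real_derivative \<psi> (Suc k) t) (at t)"
    and "\<And>t. 0 \<le> t \<Longrightarrow> t \<le> 1 \<Longrightarrow> \<bar>\<psi> n t - \<psi> n 0\<bar> \<le> C * t"
    and "0 \<le> t" "t \<le> 1"
  shows "\<bar>\<psi> 0 t - (\<Sum>k\<le>n. \<psi> k 0 * t ^ k / fact k)\<bar> \<le> C * t ^ Suc n / fact (Suc n)"
  using assms
proof (induction n arbitrary: \<psi> t)
  case (Suc n)
  define E where "E = (\<lambda>t. \<psi> 0 t - (\<Sum>k\<le>Suc n. \<psi> k 0 * t ^ k / fact k))"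
  define E' where "E' = (\<lambda>t. \<psi> 1 t - (\<Sum>k\<le>n. \<psi> (Suc k) 0 * t ^ k / fact k))"
  define G where "G = (\<lambda>t. C * t ^ Suc (Suc n) / fact (Suc (Suc n)))"
  have E: "(E has_real_derivative E' t) (at t)" if "0 \<le> t" "t \<le> 1" for t
  proof -
    have "((\<lambda>t. \<psi> (Suc k) 0 * t ^ Suc k / fact (Suc k)) has_real_derivative
        \<psi> (Suc k) 0 * t ^ k / fact k) (at t)" for k
    proof -
      have "((\<lambda>t. \<psi> (Suc k) 0 * t ^ Suc k / fact (Suc k)) has_real_derivative
          \<psi> (Suc k) 0 * (real (Suc k) * t ^ k) / fact (Suc k)) (at t)"
        using DERIV_pow[of "Suc k" t] by (intro DERIV_cdivide DERIV_cmult) simp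
      then show ?thesis by (simp add: fact_Suc del: of_nat_Suc power_Suc)
    qed
    then have "((\<lambda>t. \<psi> 0 t - (\<psi> 0 0 + (\<Sum>k\<le>n. \<psi> (Suc k) 0 * t ^ Suc k / fact (Suc k))))
        has_real_derivative \<psi> (Suc 0) t - (0 + (\<Sum>k\<le>n. \<psi> (Suc k) 0 * t ^ k / fact k))) (at t)"
      using that by (intro DERIV_diff Suc.prems(1) DERIV_add DERIV_const DERIV_sum) auto
    then show ?thesis
      by (simp add: E_def E'_def sum.atMost_Suc_shift del: sum.atMost_Suc)
  qed
  have G: "(G has_real_derivative C * t ^ Suc n / fact (Suc n)) (at t)" for t
    unfolding G_def by (rule derivative_eq_intros refl | simp add: divide_simps del: power_Suc)+
  have bd: "\<bar>E' t\<bar> \<le> C * t ^ Suc n / fact (Suc n)" if "0 \<le> t" "t \<le> 1" for t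
    unfolding E'_def
    using Suc.IH[of "\<lambda>k. \<psi> (Suc k)" t] Suc.prems(1,2) that by simp
  \<comment> \<open>Monotonicity of G - E and of G + E replaces integrating the bound on the
    derivative E'.\<close>
  have "G 0 - E 0 \<le> G t - E t"
  proof (rule DERIV_nonneg_imp_nondecreasing[OF Suc.prems(3)])
    fix s assume s: "0 \<le> s" "s \<le> t"
    then show "\<exists>y. ((\<lambda>t. G t - E t) has_real_derivative y) (at s) \<and> 0 \<le> y"
      using DERIV_diff[OF G[of s] E[of s]] bd[of s] Suc.prems(4)
      by (intro exI[of _ "C * s ^ Suc n / fact (Suc n) - E' s"]) auto
  qed
  moreover have "G 0 + E 0 \<le> G t + E t"
  proof (rule DERIV_nonneg_imp_nondecreasing[OF Suc.prems(3)])
    fix s assume s: "0 \<le> s" "s \<le> t"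
    then show "\<exists>y. ((\<lambda>t. G t + E t) has_real_derivative y) (at s) \<and> 0 \<le> y"
      using DERIV_add[OF G[of s] E[of s]] bd[of s] Suc.prems(4)
      by (intro exI[of _ "C * s ^ Suc n / fact (Suc n) + E' s"]) auto
  qed
  moreover have "E 0 = 0" "G 0 = 0"
    by (simp_all add: E_def G_def sum.atMost_Suc_shift del: sum.atMost_Suc)
  ultimately show ?case unfolding E_def[symmetric] G_def[symmetric]
    by (simp add: E_def G_def abs_le_iff del: sum.atMost_Suc) 
qed (use assms in auto)

text \<open>The product rule leaves the distinguished argument in front, whereas differentiating the
  gradient along a segment prepends directions and leaves it at the end. This reconciles the two
  positions.\<close>

lemma symmetric_form_rotate:
  assumes "symmetric_form (Suc n) A"
  shows "A (u # replicate n h) = A (replicate n h @ [u])"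
  using assms
proof (induction n arbitrary: A)
  case (Suc n)
  have "A (u # h # replicate n h) = A (h # u # replicate n h)"
    by (rule symmetric_form_swap[OF Suc.prems]) simp
  also have "\<dots> = A (h # replicate n h @ [u])"
    by (rule Suc.IH[OF symmetric_form_Cons[OF Suc.prems]])
  finally show ?case by simp
qed simp

lemma multilinear_form_replicate_DERIV:
  fixes A :: "'a::euclidean_space list \<Rightarrow> real"
  assumes "multilinear_form n A" "symmetric_form n A"
  shows "((\<lambda>t. A (replicate n (h + t *\<^sub>R u))) has_real_derivative
           real n * A (replicate (n - 1) h @ [u])) (at 0)"
  using assms
proof (induction n arbitrary: A)
  case (Suc n)
  have lin: "linear (\<lambda>v. A (v # replicate n w))" for w
    by (rule multilinear_form_linear[OF Suc.prems(1)]) simp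
  have eq: "A (replicate (Suc n) (h + t *\<^sub>R u))
      = A (h # replicate n (h + t *\<^sub>R u)) + t * A (u # replicate n (h + t *\<^sub>R u))" for t
    using linear_add[OF lin] linear_scale[OF lin] by simp
  have IH: "((\<lambda>t. A (v # replicate n (h + t *\<^sub>R u))) has_real_derivative
      real n * A (v # replicate (n - 1) h @ [u])) (at 0)" for v
    by (rule Suc.IH) (use Suc.prems multilinear_form_Cons symmetric_form_Cons in auto)
  have "((\<lambda>t. A (h # replicate n (h + t *\<^sub>R u)) + t * A (u # replicate n (h + t *\<^sub>R u))) has_real_derivative
      real n * A (h # replicate (n - 1) h @ [u]) + A (u # replicate n h)) (at 0)"
    by (rule derivative_eq_intros IH refl | simp)+
  moreover have "real n * A (h # replicate (n - 1) h @ [u]) + A (u # replicate n h)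
      = real (Suc n) * A (replicate n h @ [u])"
    using symmetric_form_rotate[OF Suc.prems(2), of u h] by (cases n) (auto simp: algebra_simps)
  ultimately show ?case unfolding eq by simp
qed simp

text \<open>The norm itself is not differentiable at 0, but its power p + 1 is, with derivative 0.
  Away from 0 the norm is the square root of a positive quadratic in t.\<close>

lemma normB_power_DERIV:
  fixes B :: "'a::euclidean_space \<Rightarrow> 'a"
  assumes B: "selfadj_posdef B" and p: "p \<ge> 2"
  shows "((\<lambda>t. normB B (h + t *\<^sub>R v) ^ (p + 1)) has_real_derivative
           real (p + 1) * normB B h ^ (p - 1) * (B h \<bullet> v)) (at 0)"
proof (cases "h = 0")
  case True
  \<comment> \<open>Caratheodory's slope function at h = 0: multiplied by t it gives
    \<open>\<bar>t\<bar> ^ (p + 1)\<close> times the power of the norm of v.\<close>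
  have "isCont (\<lambda>t::real. \<bar>t\<bar> ^ (p - 1) * t * normB B v ^ (p + 1)) 0"
    by (intro continuous_intros)
  moreover have "\<bar>t\<bar> ^ (p + 1) = \<bar>t\<bar> ^ (p - 1) * t * t" for t :: real
  proof -
    have "p + 1 = (p - 1) + 2" using p by simp
    then have "\<bar>t\<bar> ^ (p + 1) = \<bar>t\<bar> ^ (p - 1) * \<bar>t\<bar>\<^sup>2" by (metis power_add)
    then show ?thesis by (simp add: power2_eq_square)
  qed
  ultimately show ?thesis
    unfolding CARAT_DERIV using p True
    by (intro exI[of _ "\<lambda>t. \<bar>t\<bar> ^ (p - 1) * t * normB B v ^ (p + 1)"])
      (auto simp: normB_scaleR[OF B] normB_zero[OF B] power_mult_distrib B_simps[OF B] mult_ac)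
next
  case False
  define r where "r = normB B h"
  have r: "r > 0" using False normB_nonneg[OF B, of h] normB_eq_0_iff[OF B, of h] by (simp add: r_def less_le)
  have eq: "normB B (h + t *\<^sub>R v) = sqrt (r\<^sup>2 + 2 * t * (B h \<bullet> v) + t\<^sup>2 * (B v \<bullet> v))" for t
  proof -
    have "(normB B (h + t *\<^sub>R v))\<^sup>2 = r\<^sup>2 + 2 * t * (B h \<bullet> v) + t\<^sup>2 * (B v \<bullet> v)"
      unfolding normB_add_sq[OF B] r_def normB_scaleR[OF B]
      by (simp add: power_mult_distrib normB_sq[OF B])
    then show ?thesis by (metis normB_nonneg[OF B] real_sqrt_unique)
  qed
  have "((\<lambda>t. sqrt (r\<^sup>2 + 2 * t * (B h \<bullet> v) + t\<^sup>2 * (B v \<bullet> v)) ^ (p + 1)) has_real_derivative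
      real (p + 1) * r ^ p * (inverse (sqrt (r\<^sup>2)) / 2 * (2 * (B h \<bullet> v)))) (at 0)"
    using r p by (auto intro!: derivative_eq_intros DERIV_real_sqrt simp: field_simps power_eq_if[of r p])
  moreover have "real (p + 1) * r ^ p * (inverse (sqrt (r\<^sup>2)) / 2 * (2 * (B h \<bullet> v)))
      = real (p + 1) * r ^ (p - 1) * (B h \<bullet> v)"
  proof -
    obtain n where "p = Suc n" using p by (cases p) auto
    then show ?thesis using r by (simp add: field_simps)
  qed
  ultimately show ?thesis unfolding eq r_def[symmetric] by (simp only:)
qed

context
  fixes B :: "'a::euclidean_space \<Rightarrow> 'a"
  assumes B: "selfadj_posdef B"
begin

text \<open>A real \<open>Sup\<close> is an upper bound only for a set that is bounded above; here
  the set is the continuous image of the compact unit ball.\<close>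

lemma form_norm_upper:
  assumes "multilinear_form p A" "normB B u \<le> 1"
  shows "\<bar>A (replicate p u)\<bar> \<le> form_norm B p A"
  unfolding form_norm_def
proof (rule cSup_upper)
  have "continuous_on {x. normB B x \<le> 1} (\<lambda>t. A (map (\<lambda>f. f t) (replicate p id)))"
    by (rule continuous_on_multilinear_form) (use assms(1) in auto)
  then have "continuous_on {x. normB B x \<le> 1} (\<lambda>u. \<bar>A (replicate p u)\<bar>)"
    by (intro continuous_intros) simp
  then have "bounded ((\<lambda>u. \<bar>A (replicate p u)\<bar>) ` {x. normB B x \<le> 1})"
    using compact_normB_ball[OF B] compact_continuous_image compact_imp_bounded by blast
  moreover have "(\<lambda>u. \<bar>A (replicate p u)\<bar>) ` {x. normB B x \<le> 1} = {\<bar>A (replicate p u)\<bar> |u. normB B u \<le> 1}"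
    by auto
  ultimately show "bdd_above {\<bar>A (replicate p u)\<bar> |u. normB B u \<le> 1}"
    using bounded_imp_bdd_above by metis
qed (use assms(2) in auto)

text \<open>Scalar Taylor estimate of order p - 1 for the directional derivative along v, taken on
  the segment from x to T. Its last derivative is D^p f with p - 1 arguments T - x and one argument
  v, which lies off the diagonal.\<close>

lemma gradient_taylor_bound:
  fixes f :: "'a \<Rightarrow> real"
  assumes S: "open S" "Dh \<subseteq> S" and Dh: "convex Dh" and fder: "has_derivs f Df p S" and p: "p \<ge> 1"
    and L: "0 \<le> L"
    and Lip: "\<forall>y\<in>Dh. \<forall>z\<in>Dh. form_norm B p (\<lambda>us. Df p y us - Df p z us) \<le> L * normB B (y - z)"
    and xT: "x \<in> Dh" "T \<in> Dh"
  shows "\<bar>Df 1 T [v] - (\<Sum>k<p. Df (Suc k) x (replicate k (T - x) @ [v]) / fact k)\<bar>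
           \<le> L / fact p * normB B (T - x) ^ p * normB B v"
proof -
  define h where "h = T - x"
  obtain n where n: "p = Suc n" using p by (cases p) auto
  have seg: "x + t *\<^sub>R h \<in> Dh" if "0 \<le> t" "t \<le> 1" for t
    using convexD_alt[OF Dh xT that] by (simp add: h_def algebra_simps)
  define \<psi> where "\<psi> = (\<lambda>k t. Df (Suc k) (x + t *\<^sub>R h) (replicate k h @ [v]))"
  have "\<bar>\<psi> 0 1 - (\<Sum>k\<le>n. \<psi> k 0 * 1 ^ k / fact k)\<bar>
      \<le> (L * normB B h ^ p * normB B v) * 1 ^ Suc n / fact (Suc n)"
  proof (rule taylor_remainder_bound)
    fix k and t :: real assume k: "k < n" and t: "0 \<le> t" "t \<le> 1"
    show "(\<psi> k has_real_derivative \<psi> (Suc k) t) (at t)"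
      using has_derivs_line[OF S(1) fder, of x t h "replicate k h @ [v]"] k t n seg[of t] S(2)
      by (auto simp: \<psi>_def)
  next
    fix t :: real assume t: "0 \<le> t" "t \<le> 1"
    define A where "A = (\<lambda>us. Df p (x + t *\<^sub>R h) us - Df p x us)"
    have z: "x + t *\<^sub>R h \<in> S" "x \<in> S" using seg[OF t] xT S by auto
    have ml: "multilinear_form p A"
      using has_derivs_multilinear[OF S(1) fder, of p] z unfolding A_def multilinear_form_def
      by (auto intro!: linear_compose_sub)
    have sy: "symmetric_form p A"
      using has_derivs_symmetric[OF S(1) fder, of p] z unfolding A_def symmetric_form_def by auto
    have "\<bar>A (replicate p u)\<bar> \<le> L * (t * normB B h)" if "normB B u = 1" for u
    proof -
      have "\<bar>A (replicate p u)\<bar> \<le> form_norm B p A" by (rule form_norm_upper[OF ml]) (simp add: that)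
      also have "\<dots> \<le> L * normB B (x + t *\<^sub>R h - x)"
        unfolding A_def using Lip seg[OF t] xT(1) by blast
      finally show ?thesis using t by (simp add: normB_scaleR[OF B])
    qed
    \<comment> \<open>Banach's theorem transfers the diagonal Lipschitz bound to the mixed arguments
      without loss, so the constant L / p! stays free of a polarization factor.\<close>
    from norm_form_diagonal[OF B ml sy _ this, of "replicate n h @ [v]"]
    have "\<bar>A (replicate n h @ [v])\<bar> \<le> L * (t * normB B h) * (normB B h ^ n * normB B v)"
      using n by simp
    then show "\<bar>\<psi> n t - \<psi> n 0\<bar> \<le> L * normB B h ^ p * normB B v * t"
      by (simp add: \<psi>_def A_def n mult_ac)
  qed auto
  then show ?thesis by (simp add: \<psi>_def h_def n lessThan_Suc_atMost mult_ac)
qed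

end

text \<open>Since k / k! = 1 / (k-1)!, the derivative of the Taylor model at T is exactly the
  polynomial that approximates the gradient of f in \<open>gradient_taylor_bound\<close>.\<close>

lemma taylor_DERIV:
  assumes S: "open S" "x \<in> S" and fder: "has_derivs f Df p S"
  shows "((\<lambda>t. taylor f Df p x (T + t *\<^sub>R v)) has_real_derivative
      (\<Sum>k<p. Df (Suc k) x (replicate k (T - x) @ [v]) / fact k)) (at 0)"
proof -
  have "((\<lambda>t. f x + (\<Sum>k\<in>{1..p}. Df k x (replicate k ((T - x) + t *\<^sub>R v)) / fact k)) has_real_derivative
      0 + (\<Sum>k\<in>{1..p}. real k * Df k x (replicate (k - 1) (T - x) @ [v]) / fact k)) (at 0)"
    by (intro DERIV_add DERIV_const DERIV_sum DERIV_cdivide multilinear_form_replicate_DERIV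
      has_derivs_multilinear[OF S(1) fder] has_derivs_symmetric[OF S(1) fder]) (use S in auto)
  moreover have "(\<Sum>k\<in>{1..p}. real k * Df k x (replicate (k - 1) (T - x) @ [v]) / fact k)
      = (\<Sum>k<p. Df (Suc k) x (replicate k (T - x) @ [v]) / fact k)"
    by (rule sum.reindex_bij_witness[of _ Suc "\<lambda>k. k - 1"])
      (auto simp: fact_reduce divide_simps)
  ultimately show ?thesis by (simp add: taylor_def algebra_simps)
qed


section \<open>Convexity, existence of minimisers, growth from uniform convexity\<close>

text \<open>A segment between two points of dom h may leave it beyond its end points, so comparisons
  are available only to the right of 0, while the smooth part is differentiable from both
  sides.\<close>

lemma DERIV_le_of_right_bound:
  fixes u :: "real \<Rightarrow> real"
  assumes "(u has_real_derivative d) (at 0)"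
    and "\<And>t. 0 < t \<Longrightarrow> t \<le> 1 \<Longrightarrow> u t - u 0 \<le> t * c"
  shows "d \<le> c"
proof (rule tendsto_upperbound)
  have "((\<lambda>t. (u t - u 0) / t) \<longlongrightarrow> d) (at 0)"
    using assms(1) by (simp add: has_field_derivative_iff)
  then show "((\<lambda>t. (u t - u 0) / t) \<longlongrightarrow> d) (at_right 0)"
    by (rule tendsto_mono[rotated]) (simp add: at_le)
  have "(u t - u 0) / t \<le> c" if "0 < t" "t < 1" for t
    using assms(2)[of t] that by (simp add: divide_le_eq mult.commute)
  then show "\<forall>\<^sub>F t in at_right 0. (u t - u 0) / t \<le> c"
    by (auto simp: eventually_at_right_field intro!: exI[of _ 1])
qed simp

lemma convex_on_above_tangent:
  fixes f :: "'a::real_vector \<Rightarrow> real"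
  assumes "convex_on S f" "x \<in> S" "y \<in> S"
    and "((\<lambda>t. f (x + t *\<^sub>R (y - x))) has_real_derivative d) (at 0)"
  shows "f x + d \<le> f y"
proof -
  have "d \<le> f y - f x"
  proof (rule DERIV_le_of_right_bound[OF assms(4)])
    fix t :: real assume t: "0 < t" "t \<le> 1"
    have "f ((1 - t) *\<^sub>R x + t *\<^sub>R y) \<le> (1 - t) * f x + t * f y"
      using convex_onD[OF assms(1), of t x y] t assms(2,3) by simp
    then show "f (x + t *\<^sub>R (y - x)) - f (x + 0 *\<^sub>R (y - x)) \<le> t * (f y - f x)"
      by (simp add: algebra_simps)
  qed
  then show ?thesis by simp
qed

text \<open>A limit of points of D might a priori lie outside S, where f is not controlled. The
  affine minorant of f bounds h along the sequence, so closedness of the epigraph of h puts the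
  limit in D; continuity of f there then gives the sharp inequality.\<close>

lemma closed_epigraph_add:
  fixes f h :: "'a::euclidean_space \<Rightarrow> real"
  assumes h: "closed {(y, t). y \<in> D \<and> h y \<le> t}" and "D \<subseteq> S"
    and f: "\<And>y. y \<in> S \<Longrightarrow> isCont f y"
    and minorant: "\<And>y. y \<in> D \<Longrightarrow> c + g \<bullet> y \<le> f y"
  shows "closed {(y, t). y \<in> D \<and> f y + h y \<le> t}"
  unfolding closed_sequential_limits
proof (intro allI impI, elim conjE)
  fix z :: "nat \<Rightarrow> 'a \<times> real" and l
  assume z: "\<forall>n. z n \<in> {(y, t). y \<in> D \<and> f y + h y \<le> t}" and lim: "z \<longlonglongrightarrow> l"
  define y t where "y = (\<lambda>n. fst (z n))" and "t = (\<lambda>n. snd (z n))"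
  have yt: "y n \<in> D" "f (y n) + h (y n) \<le> t n" for n
    using z[rule_format, of n] by (auto simp: y_def t_def split: prod.splits)
  have ylim: "y \<longlonglongrightarrow> fst l" and tlim: "t \<longlonglongrightarrow> snd l"
    unfolding y_def t_def using lim by (auto intro: tendsto_fst tendsto_snd)
  have epi: "(fst l, r) \<in> {(y, t). y \<in> D \<and> h y \<le> t}"
    if "\<And>n. h (y n) \<le> r' n" "r' \<longlonglongrightarrow> r" for r' r
    by (rule closed_sequentially[OF h, of "\<lambda>n. (y n, r' n)"])
      (use that yt(1) ylim in \<open>auto intro: tendsto_Pair\<close>)
  have "(fst l, snd l - (c + g \<bullet> fst l)) \<in> {(y, t). y \<in> D \<and> h y \<le> t}"
  proof (rule epi)
    show "h (y n) \<le> t n - (c + g \<bullet> y n)" for n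
      using yt[of n] minorant[of "y n"] by linarith
  qed (intro tendsto_intros ylim tlim)
  then have lD: "fst l \<in> D" by simp
  then have "(\<lambda>n. f (y n)) \<longlonglongrightarrow> f (fst l)"
    using f \<open>D \<subseteq> S\<close> ylim by (intro isCont_tendsto_compose[of _ f]) auto
  have "(fst l, snd l - f (fst l)) \<in> {(y, t). y \<in> D \<and> h y \<le> t}"
  proof (rule epi)
    show "h (y n) \<le> t n - f (y n)" for n
      using yt(2)[of n] by linarith
  qed (intro tendsto_intros \<open>(\<lambda>n. f (y n)) \<longlonglongrightarrow> f (fst l)\<close> tlim)
  then show "l \<in> {(y, t). y \<in> D \<and> f y + h y \<le> t}"
    using lD by (auto simp: case_prod_beta)
qed

text \<open>The height is minimised over the part of the epigraph between m and \<phi> z. This part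
  is compact, and a point of least height lies over a minimiser.\<close>

lemma closed_epigraph_attains_inf:
  fixes \<phi> :: "'a::euclidean_space \<Rightarrow> real"
  assumes epi: "closed {(y, t). y \<in> D \<and> \<phi> y \<le> t}" and z: "z \<in> D"
    and bnd: "bounded {y \<in> D. \<phi> y \<le> \<phi> z}" and lower: "\<And>y. y \<in> D \<Longrightarrow> m \<le> \<phi> y"
  obtains y where "y \<in> D" "\<And>x. x \<in> D \<Longrightarrow> \<phi> y \<le> \<phi> x"
proof -
  define E where "E = {(y, t). y \<in> D \<and> \<phi> y \<le> t} \<inter> (UNIV \<times> {m..\<phi> z})"
  have "closed E" unfolding E_def by (intro closed_Int epi closed_Times) auto
  moreover have "bounded E"
    by (rule bounded_subset[OF bounded_Times[OF bnd bounded_closed_interval[of m "\<phi> z"]]])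
      (auto simp: E_def)
  ultimately have "compact E" by (simp add: compact_eq_bounded_closed)
  moreover have zE: "(z, \<phi> z) \<in> E" using z lower by (auto simp: E_def)
  moreover have "continuous_on E snd" by (intro continuous_on_snd continuous_on_id)
  ultimately obtain e where e: "e \<in> E" "\<And>w. w \<in> E \<Longrightarrow> snd e \<le> snd w"
    using continuous_attains_inf[of E snd] by blast
  obtain y t where yt: "e = (y, t)" by (cases e)
  show ?thesis
  proof (rule that)
    show "y \<in> D" using e(1) yt by (simp add: E_def)
    fix x assume x: "x \<in> D"
    show "\<phi> y \<le> \<phi> x"
    proof (cases "\<phi> x \<le> \<phi> z")
      case True
      then have "(x, \<phi> x) \<in> E" using x lower by (auto simp: E_def)
      then show ?thesis using e yt by (force simp: E_def)
    next
      case False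
      then show ?thesis using e(1) yt by (auto simp: E_def)
    qed
  qed
qed

context
  fixes B :: "'a::euclidean_space \<Rightarrow> 'a"
  assumes B: "selfadj_posdef B"
begin

text \<open>Contracting towards xs by the factor l brings the level c' down to F x0, since l (c' - F
  xs) = F x0 - F xs; the contracted point is within D of xs. The strict inequality F xs < F x0 keeps
  l positive, and c' \<ge> F x0 keeps it at most 1.\<close>

lemma convex_sublevel_bounded:
  fixes F :: "'a \<Rightarrow> real"
  assumes "convex_on X F" "xs \<in> X" "x0 \<in> X" "F xs < F x0"
    and D: "\<And>y. y \<in> X \<Longrightarrow> F y \<le> F x0 \<Longrightarrow> normB B (y - xs) \<le> D"
  shows "bounded {y \<in> X. F y \<le> c}"
proof -
  define c' where "c' = max c (F x0)"
  define l where "l = (F x0 - F xs) / (c' - F xs)"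
  have c': "c \<le> c'" "F x0 \<le> c'" by (auto simp: c'_def)
  have l: "0 < l" "l \<le> 1" "l * (c' - F xs) = F x0 - F xs"
    using assms(4) c' by (auto simp: l_def divide_simps)
  have "normB B (y - xs) \<le> D / l" if y: "y \<in> X" "F y \<le> c" for y
  proof -
    let ?z = "(1 - l) *\<^sub>R xs + l *\<^sub>R y"
    have "?z \<in> X" using assms(1,2) y l convexD_alt[of X xs y l] by (auto simp: convex_on_def)
    moreover have "F ?z \<le> F x0"
    proof -
      have "F ?z \<le> (1 - l) * F xs + l * F y"
        using convex_onD[OF assms(1), of l xs y] l assms(2) y by simp
      also have "\<dots> = F xs + l * (F y - F xs)" by (simp add: algebra_simps)
      also have "\<dots> \<le> F xs + l * (c' - F xs)"
        using l(1) y(2) c' by (intro add_mono mult_left_mono) auto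
      finally show ?thesis using l(3) by simp
    qed
    ultimately have "normB B (?z - xs) \<le> D" using D by blast
    moreover have "?z - xs = l *\<^sub>R (y - xs)" by (simp add: algebra_simps)
    ultimately show ?thesis using l by (simp add: normB_scaleR[OF B] pos_le_divide_eq mult.commute)
  qed
  then have "{y \<in> X. F y \<le> c} \<subseteq> (\<lambda>z. xs + z) ` {z. normB B z \<le> D / l}"
    by (force intro: image_eqI[where x = "_ - xs"])
  then show ?thesis
    using bounded_translation[OF bounded_normB_ball[OF B]] bounded_subset by blast
qed

text \<open>The points Y s minimise F minus the linear functional s B w, so s B w is a subgradient there
even if the segment from T to xs has no subgradients in its interior. The function
s (B w, Y s) - F (Y s), a restriction of the conjugate of F, has derivative (B w, Y s).\<close>

lemma unif_convex_gap_bound: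
  fixes F :: "'a \<Rightarrow> real"
  assumes uc: "unif_convex Dh F B q \<sigma>" and \<sigma>: "\<sigma> > 0" and q: "q \<ge> 2"
    and xs: "xs \<in> Dh"
    and T: "T \<in> Dh" "B w \<in> subdiff Dh F T"
    and ex: "\<And>s. 0 \<le> s \<Longrightarrow> s < 1 \<Longrightarrow> \<exists>y\<in>Dh. B (s *\<^sub>R w) \<in> subdiff Dh F y"
  shows "F T - F xs \<le> (q - 1) / q * (normB B w * (normB B w / \<sigma>) powr (1 / (q - 1)))"
proof -
  define N where "N = normB B w"
  define \<gamma> where "\<gamma> = 1 / (q - 1)"
  define C where "C = N * (N / \<sigma>) powr \<gamma>"
  have \<gamma>: "\<gamma> > 0" "(q - 1) * \<gamma> = 1" using q by (auto simp: \<gamma>_def)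
  have N: "N \<ge> 0" by (simp add: N_def normB_nonneg[OF B])
  then have C: "C \<ge> 0" by (simp add: C_def)
  have "\<forall>s\<in>{0..1}. \<exists>y\<in>Dh. B (s *\<^sub>R w) \<in> subdiff Dh F y \<and> (s = 1 \<longrightarrow> y = T)"
  proof
    fix s :: real assume "s \<in> {0..1}"
    then show "\<exists>y\<in>Dh. B (s *\<^sub>R w) \<in> subdiff Dh F y \<and> (s = 1 \<longrightarrow> y = T)"
      using ex[of s] T by (cases "s = 1") auto
  qed
  then obtain Y where "\<forall>s\<in>{0..1}. Y s \<in> Dh \<and> B (s *\<^sub>R w) \<in> subdiff Dh F (Y s) \<and> (s = 1 \<longrightarrow> Y s = T)"
    by (metis bchoice)
  then have Y: "\<And>s. 0 \<le> s \<Longrightarrow> s \<le> 1 \<Longrightarrow> Y s \<in> Dh"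
    "\<And>s. 0 \<le> s \<Longrightarrow> s \<le> 1 \<Longrightarrow> B (s *\<^sub>R w) \<in> subdiff Dh F (Y s)" "Y 1 = T"
    by auto
  define a where "a = (\<lambda>s. B w \<bullet> Y s)"
  define \<Phi> where "\<Phi> = (\<lambda>s. s * a s - F (Y s))"
  \<comment> \<open>Uniform convexity for the pair Y t, Y s bounds \<sigma> d^q by |t - s| N d,
    hence d^(q-1) by |t - s| N / \<sigma>. So \<open>a\<close> is Hoelder continuous with exponent
    \<gamma> = 1/(q-1).\<close>
  have acont: "\<bar>a t - a s\<bar> \<le> C * \<bar>t - s\<bar> powr \<gamma>" if "0 \<le> s" "s \<le> 1" "0 \<le> t" "t \<le> 1" for s t
  proof -
    define d where "d = normB B (Y t - Y s)"
    have d0: "d \<ge> 0" by (simp add: d_def normB_nonneg[OF B])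
    have CS: "\<bar>a t - a s\<bar> \<le> N * d"
      using B_Cauchy_Schwarz[OF B, of w "Y t - Y s"] B_Cauchy_Schwarz[OF B, of w "Y s - Y t"]
        normB_minus[OF B, of "Y t" "Y s"] unfolding a_def d_def N_def inner_diff_right
      by simp
    have "\<sigma> * d powr q \<le> (B (t *\<^sub>R w) - B (s *\<^sub>R w)) \<bullet> (Y t - Y s)"
      using uc Y that unfolding unif_convex_def d_def by blast
    also have "\<dots> = (t - s) * (a t - a s)"
      by (simp add: a_def B_simps[OF B] algebra_simps)
    also have "\<dots> \<le> \<bar>t - s\<bar> * (N * d)"
      using CS mult_left_mono[OF CS, of "\<bar>t - s\<bar>"] abs_ge_self[of "(t - s) * (a t - a s)"]
      by (simp add: abs_mult)
    finally have mono: "\<sigma> * d powr q \<le> \<bar>t - s\<bar> * (N * d)" .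
    have "d \<le> (\<bar>t - s\<bar> * (N / \<sigma>)) powr \<gamma>"
    proof (cases "d = 0")
      case False
      then have d: "d > 0" using d0 by simp
      have "d powr q = d powr (q - 1) * d" using d by (simp add: powr_diff)
      then have "d powr (q - 1) \<le> \<bar>t - s\<bar> * (N / \<sigma>)"
        using mono d \<sigma> by (simp add: field_simps)
      then have "(d powr (q - 1)) powr \<gamma> \<le> (\<bar>t - s\<bar> * (N / \<sigma>)) powr \<gamma>"
        using \<gamma> by (intro powr_mono2) auto
      then show ?thesis using d \<gamma>(2) by (simp add: powr_powr)
    qed simp
    then have "N * d \<le> N * (\<bar>t - s\<bar> * (N / \<sigma>)) powr \<gamma>" using N by (rule mult_left_mono)
    also have "\<dots> = C * \<bar>t - s\<bar> powr \<gamma>"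
      using powr_mult[of "\<bar>t - s\<bar>" "N / \<sigma>" \<gamma>] by (simp add: C_def mult_ac)
    finally show ?thesis using CS by linarith
  qed
  have sub: "(t - s) * a s \<le> \<Phi> t - \<Phi> s" if "0 \<le> s" "s \<le> 1" "0 \<le> t" "t \<le> 1" for s t
  proof -
    have "F (Y s) \<ge> F (Y t) + B (t *\<^sub>R w) \<bullet> (Y s - Y t)"
      using Y that by (auto simp: subdiff_def)
    then show ?thesis by (simp add: \<Phi>_def a_def B_simps[OF B] algebra_simps)
  qed
  \<comment> \<open>The inequality \<open>sub\<close> says that a s is a slope of \<Phi> at s.
    Exchanging s and t bounds the error above by (t - s) (a t - a s), and Hoelder continuity makes
    it of higher order.\<close>
  have est: "\<bar>\<Phi> t - \<Phi> s - (t - s) * a s\<bar> \<le> \<bar>t - s\<bar> * (C * \<bar>t - s\<bar> powr \<gamma>)"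
    if "0 \<le> s" "s \<le> 1" "0 \<le> t" "t \<le> 1" for s t
  proof -
    have "0 \<le> \<Phi> t - \<Phi> s - (t - s) * a s" using sub[OF that] by simp
    moreover have "\<Phi> t - \<Phi> s - (t - s) * a s \<le> (t - s) * (a t - a s)"
      using sub[of t s] that by (simp add: algebra_simps)
    moreover have "(t - s) * (a t - a s) \<le> \<bar>t - s\<bar> * \<bar>a t - a s\<bar>"
      by (metis abs_ge_self abs_mult)
    moreover have "\<bar>t - s\<bar> * \<bar>a t - a s\<bar> \<le> \<bar>t - s\<bar> * (C * \<bar>t - s\<bar> powr \<gamma>)"
      by (intro mult_left_mono acont that) auto
    ultimately show ?thesis by linarith
  qed
  have deriv: "(\<Phi> has_real_derivative a s) (at s)" if s: "0 < s" "s < 1" for s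
  proof -
    have "((\<lambda>t. (\<Phi> t - \<Phi> s) / (t - s) - a s) \<longlongrightarrow> 0) (at s)"
    proof (rule Lim_null_comparison)
      show "((\<lambda>t. C * \<bar>t - s\<bar> powr \<gamma>) \<longlongrightarrow> 0) (at s)"
      proof (intro tendsto_mult_right_zero tendsto_zero_powrI[where b = \<gamma>] tendsto_const)
        show "((\<lambda>t. \<bar>t - s\<bar>) \<longlongrightarrow> 0) (at s)"
          by (auto intro!: tendsto_eq_intros)
      qed (use \<gamma> in auto)
      have "\<forall>\<^sub>F t in at s. t \<in> {0<..<1}"
        using s by (intro eventually_at_in_open') auto
      moreover have "\<forall>\<^sub>F t in at s. t \<noteq> s"
        by (simp add: eventually_at_filter)
      ultimately show "\<forall>\<^sub>F t in at s. norm ((\<Phi> t - \<Phi> s) / (t - s) - a s) \<le> C * \<bar>t - s\<bar> powr \<gamma>"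
      proof eventually_elim
        case (elim t)
        have "(\<Phi> t - \<Phi> s) / (t - s) - a s = (\<Phi> t - \<Phi> s - (t - s) * a s) / (t - s)"
          using elim by (simp add: field_simps)
        then have "norm ((\<Phi> t - \<Phi> s) / (t - s) - a s) = \<bar>\<Phi> t - \<Phi> s - (t - s) * a s\<bar> / \<bar>t - s\<bar>"
          by simp
        also have "\<dots> \<le> C * \<bar>t - s\<bar> powr \<gamma>"
          using est[of s t] s elim by (simp add: divide_le_eq mult.commute)
        finally show ?case .
      qed
    qed
    then show ?thesis by (simp add: has_field_derivative_iff LIM_zero_iff)
  qed
  have cont: "continuous_on {0..1} \<Phi>"
  proof (rule lipschitz_on_continuous_on)
    \<comment> \<open>A crude constant: |a s| is at most |a 0| + C, and the error in
      \<open>est\<close> adds at most C |t - s|. Its purpose is continuity of \<Phi> up to the end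
      points.\<close>
    show "(\<bar>a 0\<bar> + 2 * C)-lipschitz_on {0..1} \<Phi>"
    proof (rule lipschitz_onI)
      fix t s :: real assume ts: "t \<in> {0..1}" "s \<in> {0..1}"
      have p1: "C * \<bar>t - s\<bar> powr \<gamma> \<le> C" if "t \<in> {0..1}" "s \<in> {0..1}" for t s
        using C \<gamma> that powr_le1[of \<gamma> "\<bar>t - s\<bar>"] by (intro mult_left_le) auto
      have "\<bar>a s\<bar> \<le> \<bar>a 0\<bar> + C" using acont[of 0 s] p1[of s 0] ts by simp
      then have "\<bar>t - s\<bar> * \<bar>a s\<bar> \<le> \<bar>t - s\<bar> * (\<bar>a 0\<bar> + C)" by (intro mult_left_mono) auto
      moreover have "\<bar>t - s\<bar> * (C * \<bar>t - s\<bar> powr \<gamma>) \<le> \<bar>t - s\<bar> * C"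
        by (intro mult_left_mono p1 ts) auto
      moreover have "\<bar>\<Phi> t - \<Phi> s\<bar> \<le> \<bar>\<Phi> t - \<Phi> s - (t - s) * a s\<bar> + \<bar>t - s\<bar> * \<bar>a s\<bar>"
        using abs_triangle_ineq[of "\<Phi> t - \<Phi> s - (t - s) * a s" "(t - s) * a s"] by (simp add: abs_mult)
      ultimately show "dist (\<Phi> t) (\<Phi> s) \<le> (\<bar>a 0\<bar> + 2 * C) * dist t s"
        using est[of s t] ts by (simp add: dist_real_def algebra_simps)
    qed (use C in simp)
  qed
  \<comment> \<open>M has derivative a 1 - a s - C (1-s)^\<gamma>, which is at most 0 by Hoelder
    continuity. Its end values are M 1 = F T and M 0 = F (Y 0) + C / (1+\<gamma>).\<close>
  define M where "M = (\<lambda>s. s * a 1 - \<Phi> s + C * (1 - s) powr (1 + \<gamma>) / (1 + \<gamma>))"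
  have "M 1 \<le> M 0"
  proof (rule DERIV_nonpos_imp_decreasing_open[where f = M and a = 0 and b = 1])
    fix s :: real assume s: "0 < s" "s < 1"
    have "((\<lambda>s. (1 - s) powr (1 + \<gamma>)) has_real_derivative - ((1 + \<gamma>) * (1 - s) powr \<gamma>)) (at s)"
      using s by (auto intro!: derivative_eq_intros)
    from DERIV_cdivide[OF DERIV_cmult[OF this, of C], of "1 + \<gamma>"]
    have 1: "((\<lambda>s. C * (1 - s) powr (1 + \<gamma>) / (1 + \<gamma>)) has_real_derivative - (C * (1 - s) powr \<gamma>)) (at s)"
      using \<gamma>(1) by (simp add: mult.left_commute)
    have "((\<lambda>s. s * a 1) has_real_derivative a 1) (at s)"
      by (auto intro!: derivative_eq_intros)
    from DERIV_add[OF DERIV_diff[OF this deriv[OF s]] 1]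
    have "(M has_real_derivative (a 1 - a s) + - (C * (1 - s) powr \<gamma>)) (at s)"
      unfolding M_def .
    moreover have "(a 1 - a s) + - (C * (1 - s) powr \<gamma>) \<le> 0"
      using acont[of s 1] s by simp
    ultimately show "\<exists>y. (M has_real_derivative y) (at s) \<and> y \<le> 0" by blast
  next
    have "continuous_on {0..1} (\<lambda>s::real. (1 - s) powr (1 + \<gamma>))"
      by (rule continuous_on_powr') (use \<gamma> in \<open>auto intro!: continuous_intros\<close>)
    then show "continuous_on {0..1} M"
      unfolding M_def using \<gamma>(1)
      by (intro continuous_on_add continuous_on_diff continuous_on_mult continuous_on_divide
          continuous_on_id continuous_on_const cont) auto
  qed simp
  then have "F T \<le> F (Y 0) + C / (1 + \<gamma>)"
    by (simp add: M_def \<Phi>_def Y(3))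
  \<comment> \<open>At s = 0 the subgradient is zero, so Y 0 minimises F over dom h.\<close>
  moreover have "F (Y 0) \<le> F xs"
    using Y(2)[of 0] xs by (auto simp: subdiff_def B_simps[OF B])
  moreover have "C / (1 + \<gamma>) = (q - 1) / q * C"
    using q by (simp add: \<gamma>_def field_simps)
  ultimately show ?thesis by (simp add: C_def N_def \<gamma>_def)
qed

end


section \<open>Scalar inequalities behind the rate\<close>

text \<open>N stands for the dual norm of the subgradient and X for its pairing with x - T. In the
  scaled variables n and \<xi> the hypothesis reads (p+1) n^2 + (p-1) \<le> 2 p \<xi>, free of a and
  r. The claim scales with the same power of r on both sides, so it reduces to n^(p+1) \<le>
  \<xi>^p.\<close>

lemma tensor_step_real:
  fixes a r N X :: real
  assumes p: "p \<ge> 2" and a: "a > 0" and r: "r > 0" and N: "N \<ge> 0"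
    and le: "N\<^sup>2 + ((real p)\<^sup>2 - 1) * a\<^sup>2 * r ^ (2 * p) \<le> 2 * real p * a * r ^ (p - 1) * X"
  shows "0 \<le> X \<and> N ^ (p + 1) \<le> (real p + 1) * a * X ^ p"
proof -
  define A where "A = (real p + 1) * a"
  define n where "n = N / (A * r ^ p)"
  define \<xi> where "\<xi> = X / (A * r ^ (p + 1))"
  have A: "A > 0" using a by (simp add: A_def)
  have Nn: "N = A * r ^ p * n" and X\<xi>: "X = A * r ^ (p + 1) * \<xi>"
    using A r by (simp_all add: n_def \<xi>_def)
  have n: "n \<ge> 0" using N A r by (simp add: n_def)
  have "2 * p = (p - 1) + (p + 1)" using p by simp
  then have r2: "r ^ (2 * p) = r ^ (p - 1) * r ^ (p + 1)" "r ^ (2 * p) = (r ^ p)\<^sup>2"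
    by (metis power_add, metis power_mult mult.commute)
  have "a * A * r ^ (2 * p) * ((real p + 1) * n\<^sup>2 + (real p - 1))
      = N\<^sup>2 + ((real p)\<^sup>2 - 1) * a\<^sup>2 * r ^ (2 * p)"
    unfolding Nn r2(2) A_def by (simp add: power2_eq_square algebra_simps)
  also have "\<dots> \<le> 2 * real p * a * r ^ (p - 1) * X" by (rule le)
  also have "\<dots> = a * A * r ^ (2 * p) * (2 * real p * \<xi>)"
    unfolding X\<xi> r2(1) by simp
  finally have main: "(real p + 1) * n\<^sup>2 + (real p - 1) \<le> 2 * real p * \<xi>"
    using a A r by simp
  have \<xi>: "\<xi> \<ge> 0"
  proof -
    have "0 \<le> (real p + 1) * n\<^sup>2 + (real p - 1)" using p by simp
    then have "0 \<le> 2 * real p * \<xi>" using main by linarith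
    then show ?thesis using p by (simp add: zero_le_mult_iff)
  qed
  have "n ^ (p + 1) \<le> \<xi> ^ p"
  proof (cases "n = 0")
    case False
    then have n: "n > 0" using n by simp
    \<comment> \<open>The weight is chosen so that 2 \<alpha> p = p + 1, and the weighted mean
      \<alpha> n^2 + (1 - \<alpha>) is exactly the left side of \<open>main\<close> divided by 2
      p.\<close>
    define \<alpha> where "\<alpha> = (real p + 1) / (2 * real p)"
    have "(n\<^sup>2) powr \<alpha> * 1 powr (1 - \<alpha>) \<le> \<alpha> * n\<^sup>2 + (1 - \<alpha>) * 1"
      using n p by (intro Youngs_inequality_0) (auto simp: \<alpha>_def divide_simps)
    also have "\<dots> = ((real p + 1) * n\<^sup>2 + (real p - 1)) / (2 * real p)"
      using p by (simp add: \<alpha>_def field_simps)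
    also have "\<dots> \<le> \<xi>"
      using main p by (subst pos_divide_le_eq) (simp_all add: mult.commute)
    finally have "((n\<^sup>2) powr \<alpha>) ^ p \<le> \<xi> ^ p" by (intro power_mono) auto
    moreover have "((n\<^sup>2) powr \<alpha>) ^ p = n powr (2 * \<alpha> * real p)"
      using n by (simp add: powr_powr mult.assoc flip: powr_realpow powr_numeral)
    moreover have "2 * \<alpha> * real p = real (p + 1)" using p by (simp add: \<alpha>_def)
    ultimately show ?thesis using n by (simp only: powr_realpow)
  qed (use \<xi> in simp)
  then have "A ^ (p + 1) * r ^ (p * (p + 1)) * n ^ (p + 1) \<le> A ^ (p + 1) * r ^ (p * (p + 1)) * \<xi> ^ p"
    using A r by (intro mult_left_mono) auto
  moreover have "N ^ (p + 1) = A ^ (p + 1) * r ^ (p * (p + 1)) * n ^ (p + 1)"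
    unfolding Nn power_mult_distrib power_mult[symmetric] ..
  moreover have "A * X ^ p = A ^ (p + 1) * r ^ (p * (p + 1)) * \<xi> ^ p"
    unfolding X\<xi> power_mult_distrib power_mult[symmetric] mult.commute[of "p + 1" p] by simp
  ultimately have "N ^ (p + 1) \<le> A * X ^ p" by (simp only:)
  moreover have "X \<ge> 0" using X\<xi> A r \<xi> by simp
  ultimately show ?thesis by (simp add: A_def)
qed

text \<open>Split \<delta>^p into \<delta>^(q-1) and \<delta>^(p-q+1), and use the uniform convexity
  bound for the first factor and the diameter bound for the second. N then occurs to the power p + 1
  and can be exchanged for A X^p. The assumption q \<le> p + 1 keeps the second exponent
  nonnegative.\<close>

lemma gap_rate_real:
  fixes \<delta> N X D q \<sigma> A :: real
  assumes p: "p \<ge> 2" and q: "2 \<le> q" "q \<le> real p + 1" and \<sigma>: "\<sigma> > 0" and D: "D > 0" and A: "A > 0"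
    and N: "N \<ge> 0" and X: "X \<ge> 0" and NX: "N ^ (p + 1) \<le> A * X ^ p"
    and 1: "\<delta> \<le> N * D" and 2: "\<delta> \<le> (q - 1) / q * (N * (N / \<sigma>) powr (1 / (q - 1)))"
  shows "\<delta> \<le> (A * ((q - 1) / q) powr (q - 1) * D powr (real p - q + 1) / \<sigma>) powr (1 / real p) * X"
    (is "_ \<le> ?\<omega> powr _ * X")
proof (cases "\<delta> \<le> 0")
  case True
  then show ?thesis using X by (meson mult_nonneg_nonneg order_trans powr_ge_zero)
next
  case False
  then have \<delta>: "\<delta> > 0" by simp
  have N: "N > 0" using 1 \<delta> N by (cases "N = 0") auto
  let ?\<kappa> = "((q - 1) / q) powr (q - 1)"
  have "\<delta> powr (q - 1) \<le> ((q - 1) / q * (N * (N / \<sigma>) powr (1 / (q - 1)))) powr (q - 1)"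
    using \<delta> 2 q by (intro powr_mono2) auto
  also have "\<dots> = ?\<kappa> * (N powr (q - 1) * (N / \<sigma>))"
  proof -
    have "((N / \<sigma>) powr (1 / (q - 1))) powr (q - 1) = N / \<sigma>"
      using N \<sigma> q by (simp add: powr_powr)
    then show ?thesis by (simp only: powr_mult)
  qed
  finally have a: "\<delta> powr (q - 1) \<le> ?\<kappa> * (N powr (q - 1) * (N / \<sigma>))" .
  have "\<delta> powr (real p - q + 1) \<le> (N * D) powr (real p - q + 1)"
    using \<delta> 1 q by (intro powr_mono2) auto
  also have "\<dots> = N powr (real p - q + 1) * D powr (real p - q + 1)"
    by (rule powr_mult)
  finally have b: "\<delta> powr (real p - q + 1) \<le> N powr (real p - q + 1) * D powr (real p - q + 1)" .
  have "\<delta> powr real p = \<delta> powr (q - 1) * \<delta> powr (real p - q + 1)"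
    by (simp flip: powr_add)
  also have "\<dots> \<le> (?\<kappa> * (N powr (q - 1) * (N / \<sigma>))) * (N powr (real p - q + 1) * D powr (real p - q + 1))"
    using a b N \<sigma> by (intro mult_mono) auto
  also have "\<dots> = ?\<kappa> * D powr (real p - q + 1) / \<sigma> * (N powr (q - 1) * N powr (real p - q + 1) * N)"
    by simp
  also have "N powr (q - 1) * N powr (real p - q + 1) * N = N ^ (p + 1)"
    using N by (simp add: powr_realpow flip: powr_add)
  also have "?\<kappa> * D powr (real p - q + 1) / \<sigma> * N ^ (p + 1) \<le> ?\<kappa> * D powr (real p - q + 1) / \<sigma> * (A * X ^ p)"
    using \<sigma> by (intro mult_left_mono NX) auto
  also have "\<dots> = ?\<omega> * X ^ p" by simp
  finally have "(\<delta> powr real p) powr (1 / real p) \<le> (?\<omega> * X ^ p) powr (1 / real p)"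
    by (intro powr_mono2) auto
  moreover have "(\<delta> powr real p) powr (1 / real p) = \<delta>" using \<delta> p by (simp add: powr_powr)
  moreover have "(?\<omega> * X ^ p) powr (1 / real p) = ?\<omega> powr (1 / real p) * X"
  proof -
    have "(X ^ p) powr (1 / real p) = X"
    proof (cases "X = 0")
      case False
      then show ?thesis using X p by (simp add: powr_powr flip: powr_realpow)
    qed (use p in simp)
    then show ?thesis by (simp only: powr_mult[of ?\<omega>])
  qed
  ultimately show ?thesis by simp
qed

lemma linear_rate_exp:
  fixes \<delta> \<delta>' W :: real
  assumes "\<delta>' \<le> W * (\<delta> - \<delta>')" "W \<ge> 0" "\<delta> \<ge> 0"
  shows "\<delta>' \<le> exp (- 1 / (1 + W)) * \<delta>"
proof -
  have "\<delta>' * (1 + W) \<le> W * \<delta>" using assms(1) by (simp add: algebra_simps)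
  then have "\<delta>' \<le> W * \<delta> / (1 + W)" using assms(2) by (simp add: pos_le_divide_eq)
  also have "\<dots> = (1 + (- 1 / (1 + W))) * \<delta>" using assms(2) by (simp add: field_simps)
  also have "\<dots> \<le> exp (- 1 / (1 + W)) * \<delta>"
    by (intro mult_right_mono exp_ge_add_one_self assms(3))
  finally show ?thesis .
qed

section \<open>One step of the tensor method\<close>

context
  fixes B :: "'a::euclidean_space \<Rightarrow> 'a" and f h :: "'a \<Rightarrow> real" and Df :: "nat \<Rightarrow> 'a \<Rightarrow> 'a list \<Rightarrow> real"
    and Dh S :: "'a set" and p :: nat and L :: real
  assumes B: "selfadj_posdef B"
    and p2: "p \<ge> 2"
    and h: "proper_closed_convex Dh h"
    and S: "open S" "convex S" "Dh \<subseteq> S"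
    and fconv: "convex_on S f"
    and fder: "has_derivs f Df p S"
    and L: "0 < L"
    and Lip: "\<forall>y\<in>Dh. \<forall>z\<in>Dh. form_norm B p (\<lambda>us. Df p y us - Df p z us) \<le> L * normB B (y - z)"
begin

lemma gradient_linear: "y \<in> S \<Longrightarrow> linear (\<lambda>v. Df 1 y [v])"
  using has_derivs_linear[OF S(1) fder, of "[]" "[]" y] p2 by simp

lemma f_has_derivative: "y \<in> S \<Longrightarrow> (f has_derivative (\<lambda>v. Df 1 y [v])) (at y)"
  by (rule has_derivative_transform_within_open[OF _ S(1), of "\<lambda>z. Df 0 z []"])
    (use fder p2 in \<open>auto simp: has_derivs_def\<close>)

lemma f_gradient_inequality:
  assumes "y \<in> S" "z \<in> S" shows "f y + Df 1 y [z - y] \<le> f z"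
proof (rule convex_on_above_tangent[OF fconv assms])
  have "((\<lambda>t::real. y + t *\<^sub>R (z - y)) has_derivative (\<lambda>t. t *\<^sub>R (z - y))) (at 0)"
    by (auto intro!: derivative_eq_intros)
  from has_derivative_compose[OF this, of f] f_has_derivative[OF assms(1)]
  have "((\<lambda>t. f (y + t *\<^sub>R (z - y))) has_derivative (\<lambda>t. Df 1 y [t *\<^sub>R (z - y)])) (at 0)"
    by simp
  then show "((\<lambda>t. f (y + t *\<^sub>R (z - y))) has_real_derivative Df 1 y [z - y]) (at 0)"
    using linear_scale[OF gradient_linear[OF assms(1)]]
    by (simp add: has_field_derivative_def mult_commute_abs)
qed

text \<open>First-order optimality along segments of dom h makes the negative gradient of the smooth
  part of the model a subgradient of h at T. Adding the gradient of f gives a subgradient B w of F,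
  and B w plus the regularization gradient is the Taylor error of the gradient.\<close>

lemma tensor_step_subgradient:
  assumes x: "x \<in> Dh" and TH: "is_TH B f Df p Dh h H x T"
  obtains w where "B w \<in> subdiff Dh (\<lambda>y. f y + h y) T"
    "\<And>v. \<bar>B w \<bullet> v + H / fact p * normB B (T - x) ^ (p - 1) * (B (T - x) \<bullet> v)\<bar>
          \<le> L / fact p * normB B (T - x) ^ p * normB B v"
proof -
  have T: "T \<in> Dh" using TH by (simp add: is_TH_def)
  have cDh: "convex Dh" and hconv: "convex_on Dh h" using h by (auto simp: proper_closed_convex_def)
  define r where "r = normB B (T - x)"
  define G where "G = (\<lambda>v. \<Sum>k<p. Df (Suc k) x (replicate k (T - x) @ [v]) / fact k)"
  define l where "l = (\<lambda>v. Df 1 T [v] - G v - H / fact p * r ^ (p - 1) * (B (T - x) \<bullet> v))"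
  have xS: "x \<in> S" "T \<in> S" using x T S by auto
  have linG: "linear G"
    unfolding G_def
  proof (intro linear_compose_sum ballI)
    fix k assume "k \<in> {..<p}"
    then have lin: "linear (\<lambda>v. Df (Suc k) x (replicate k (T - x) @ [v]))"
      using has_derivs_linear[OF S(1) fder, of "replicate k (T - x)" "[]" x] xS by simp
    show "linear (\<lambda>v. Df (Suc k) x (replicate k (T - x) @ [v]) / fact k)"
      by (rule linearI) (simp_all add: linear_add[OF lin] linear_scale[OF lin] add_divide_distrib)
  qed
  have "linear l"
    unfolding l_def
    by (rule linearI) (simp_all add: linear_add[OF linG] linear_scale[OF linG]
        linear_add[OF gradient_linear[OF xS(2)]] linear_scale[OF gradient_linear[OF xS(2)]]
        inner_add_right algebra_simps del: One_nat_def)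
  then obtain w where w: "\<And>v. l v = B w \<bullet> v" using dual_representation[OF B] by blast
  show ?thesis
  proof (rule that)
    show "B w \<in> subdiff Dh (\<lambda>y. f y + h y) T"
      unfolding subdiff_def
    proof (intro CollectI ballI)
      fix z assume z: "z \<in> Dh"
      define v where "v = z - T"
      \<comment> \<open>The negative of the smooth part of the model, so that minimality of T bounds
        the increase of u by the increase of h.\<close>
      define u where "u = (\<lambda>t. - (taylor f Df p x (T + t *\<^sub>R v)
          + H / fact (p + 1) * normB B ((T - x) + t *\<^sub>R v) ^ (p + 1)))"
      define c where "c = G v + H / fact (p + 1) * (real (p + 1) * normB B (T - x) ^ (p - 1) * (B (T - x) \<bullet> v))"
      have "(u has_real_derivative - c) (at 0)"
        unfolding u_def c_def G_def
        by (intro DERIV_minus DERIV_add DERIV_cmult taylor_DERIV[OF S(1) xS(1) fder] normB_power_DERIV[OF B p2])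
      then have "- c \<le> h z - h T"
      proof (rule DERIV_le_of_right_bound)
        fix t :: real assume t: "0 < t" "t \<le> 1"
        have eq: "T + t *\<^sub>R v = (1 - t) *\<^sub>R T + t *\<^sub>R z" by (simp add: v_def algebra_simps)
        have "T + t *\<^sub>R v \<in> Dh"
          unfolding eq using convexD_alt[OF cDh T z] t by simp
        then have "u t - u 0 \<le> h (T + t *\<^sub>R v) - h T"
          using TH by (force simp: is_TH_def u_def algebra_simps)
        also have "h (T + t *\<^sub>R v) \<le> (1 - t) * h T + t * h z"
          unfolding eq using convex_onD[OF hconv, of t T z] t T z by simp
        finally show "u t - u 0 \<le> t * (h z - h T)" by (simp add: algebra_simps)
      qed
      moreover have "f T + Df 1 T [v] \<le> f z"
        unfolding v_def by (rule f_gradient_inequality) (use xS z S in auto)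
      moreover have "c = G v + H / fact p * r ^ (p - 1) * (B (T - x) \<bullet> v)"
        by (simp add: c_def r_def fact_Suc divide_simps del: of_nat_Suc)
      ultimately show "f T + h T + B w \<bullet> (z - T) \<le> f z + h z"
        using w[of v] by (simp add: l_def v_def)
    qed
    show "\<bar>B w \<bullet> v + H / fact p * normB B (T - x) ^ (p - 1) * (B (T - x) \<bullet> v)\<bar>
        \<le> L / fact p * normB B (T - x) ^ p * normB B v" for v
      using gradient_taylor_bound[OF B S(1,3) cDh fder _ _ Lip x T, of v] p2 L w[of v]
      by (simp add: l_def r_def G_def)
  qed
qed

lemma tensor_step_progress:
  assumes x: "x \<in> Dh" and TH: "is_TH B f Df p Dh h (real p * L) x T"
  obtains w where "B w \<in> subdiff Dh (\<lambda>y. f y + h y) T" "0 \<le> B w \<bullet> (x - T)"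
    "normB B w ^ (p + 1) \<le> (real p + 1) / fact p * L * (B w \<bullet> (x - T)) ^ p"
proof -
  obtain w where w: "B w \<in> subdiff Dh (\<lambda>y. f y + h y) T"
    "\<And>v. \<bar>B w \<bullet> v + real p * L / fact p * normB B (T - x) ^ (p - 1) * (B (T - x) \<bullet> v)\<bar>
          \<le> L / fact p * normB B (T - x) ^ p * normB B v"
    using tensor_step_subgradient[OF assms] by metis
  define a where "a = L / fact p"
  define r where "r = normB B (T - x)"
  define k where "k = real p * a * r ^ (p - 1)"
  have a: "a > 0" using L by (simp add: a_def)
  have r: "r \<ge> 0" by (simp add: r_def normB_nonneg[OF B])
  have bd: "\<bar>B (w + k *\<^sub>R (T - x)) \<bullet> v\<bar> \<le> a * r ^ p * normB B v" for v
    using w(2)[of v]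
    by (simp add: linear_add[OF linB[OF B]] linear_scale[OF linB[OF B]] inner_add_left k_def a_def r_def)
  \<comment> \<open>Testing the functional bound at its own representer turns it into a bound on the
    dual norm.\<close>
  have "(normB B (w + k *\<^sub>R (T - x)))\<^sup>2 \<le> a * r ^ p * normB B (w + k *\<^sub>R (T - x))"
    using bd[of "w + k *\<^sub>R (T - x)"] unfolding normB_sq[OF B] by linarith
  then have "normB B (w + k *\<^sub>R (T - x)) \<le> a * r ^ p"
    using normB_nonneg[OF B, of "w + k *\<^sub>R (T - x)"] a r unfolding power2_eq_square
    by (metis mult_le_cancel_right less_le mult_nonneg_nonneg zero_le_power)
  then have "(normB B (w + k *\<^sub>R (T - x)))\<^sup>2 \<le> (a * r ^ p)\<^sup>2"
    by (intro power_mono normB_nonneg[OF B])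
  then have sq: "(normB B w)\<^sup>2 + 2 * k * (B w \<bullet> (T - x)) + k\<^sup>2 * r\<^sup>2 \<le> a\<^sup>2 * r ^ (2 * p)"
    unfolding normB_add_sq[OF B] normB_scaleR[OF B]
    by (simp add: r_def power_mult_distrib power_mult[symmetric] mult.commute[of p])
  have k2: "k\<^sup>2 * r\<^sup>2 = (real p)\<^sup>2 * a\<^sup>2 * r ^ (2 * p)"
  proof -
    have "r ^ (p - 1) * r = r ^ p" using p2 by (intro power_minus_mult) simp
    then have "k * r = real p * a * r ^ p" by (simp add: k_def)
    then have "(k * r)\<^sup>2 = (real p * a * r ^ p)\<^sup>2" by simp
    then show ?thesis by (simp add: power_mult_distrib power_mult[symmetric] mult.commute[of p])
  qed
  have opp: "B w \<bullet> (T - x) = - (B w \<bullet> (x - T))" by (simp add: inner_diff_right)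
  have "0 \<le> B w \<bullet> (x - T) \<and> normB B w ^ (p + 1) \<le> (real p + 1) * a * (B w \<bullet> (x - T)) ^ p"
  proof (cases "r = 0")
    \<comment> \<open>A step of length zero is excluded from the scaling argument, which divides by
      powers of r. Here the squared bound forces w to vanish, and T = x makes both claims
      trivial.\<close>
    case True
    then have "T = x" by (simp add: r_def normB_eq_0_iff[OF B])
    moreover have k0: "k = 0" and r0: "r ^ (2 * p) = 0"
      using True p2 by (simp_all add: k_def zero_power)
    have "(normB B w)\<^sup>2 \<le> 0" using sq unfolding k0 r0 by simp
    then have "normB B w = 0" by simp
    ultimately show ?thesis using p2 a by simp
  next
    case False
    show ?thesis
    proof (rule tensor_step_real[OF p2 a])
      show "r > 0" using False r by simp
      show "(normB B w)\<^sup>2 + ((real p)\<^sup>2 - 1) * a\<^sup>2 * r ^ (2 * p) \<le> 2 * real p * a * r ^ (p - 1) * (B w \<bullet> (x - T))"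
        using sq unfolding k2 opp by (simp add: k_def algebra_simps)
    qed (simp add: normB_nonneg[OF B])
  qed
  then show ?thesis using that[OF w(1)] by (simp add: a_def)
qed

lemma convex_on_F: "convex_on Dh (\<lambda>y. f y + h y)"
  using h convex_on_subset[OF fconv S(3)] by (intro convex_on_add) (auto simp: proper_closed_convex_def)

text \<open>The tilted function is (1-s) F + s (F - (B w, .)), and its second part is smallest at T.
  For s < 1 its sublevel set therefore lies in a sublevel set of F and is bounded, so a minimiser
  exists; minimality there says that s B w is a subgradient of F.\<close>

lemma tilted_minimizer:
  assumes xs: "xs \<in> Dh" "\<And>y. y \<in> Dh \<Longrightarrow> f xs + h xs \<le> f y + h y"
    and sublevel: "\<And>c. bounded {y \<in> Dh. f y + h y \<le> c}"
    and T: "T \<in> Dh" "B w \<in> subdiff Dh (\<lambda>y. f y + h y) T"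
    and s: "0 \<le> s" "s < 1"
  shows "\<exists>y\<in>Dh. B (s *\<^sub>R w) \<in> subdiff Dh (\<lambda>y. f y + h y) y"
proof -
  define F where "F = (\<lambda>y. f y + h y)"
  define \<phi> where "\<phi> = (\<lambda>y. (f y - s * (B w \<bullet> y)) + h y)"
  obtain g where g: "\<And>v. Df 1 T [v] = B g \<bullet> v"
    using dual_representation[OF B gradient_linear, of T] T(1) S by blast
  have TS: "T \<in> S" using T S by auto
  have epi: "closed {(y, t). y \<in> Dh \<and> \<phi> y \<le> t}"
    unfolding \<phi>_def
  \<comment> \<open>The affine minorant is the tangent of f at T minus the tilt.\<close>
  proof (rule closed_epigraph_add[of _ _ S _ "f T - B g \<bullet> T" "B g - s *\<^sub>R B w"])
    show "closed {(y, t). y \<in> Dh \<and> h y \<le> t}" using h by (simp add: proper_closed_convex_def)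
    show "isCont (\<lambda>y. f y - s * (B w \<bullet> y)) y" if "y \<in> S" for y
      using has_derivative_continuous[OF f_has_derivative[OF that]] by (intro continuous_intros)
    show "f T - B g \<bullet> T + (B g - s *\<^sub>R B w) \<bullet> y \<le> f y - s * (B w \<bullet> y)" if "y \<in> Dh" for y
      using f_gradient_inequality[of T y] TS that S g[of "y - T"]
      by (auto simp: inner_diff_left inner_diff_right)
  qed (rule S(3))
  have split: "\<phi> y = (1 - s) * F y + s * (F y - B w \<bullet> y)" for y
    by (simp add: \<phi>_def F_def algebra_simps)
  have sT: "s * (F T - B w \<bullet> T) \<le> s * (F y - B w \<bullet> y)" if "y \<in> Dh" for y
    using T(2) that s by (intro mult_left_mono) (force simp: subdiff_def F_def inner_diff_right)+
  have lower: "(1 - s) * F xs + s * (F T - B w \<bullet> T) \<le> \<phi> y" if "y \<in> Dh" for y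
    unfolding split
    by (intro add_mono sT[OF that] mult_left_mono) (use s xs(2)[OF that] in \<open>auto simp: F_def\<close>)
  have "bounded {y \<in> Dh. \<phi> y \<le> \<phi> T}"
  proof (rule bounded_subset[OF sublevel[of "(\<phi> T - s * (F T - B w \<bullet> T)) / (1 - s)"]])
    show "{y \<in> Dh. \<phi> y \<le> \<phi> T} \<subseteq> {y \<in> Dh. f y + h y \<le> (\<phi> T - s * (F T - B w \<bullet> T)) / (1 - s)}"
    proof clarify
      fix y assume y: "y \<in> Dh" "\<phi> y \<le> \<phi> T"
      then have "(1 - s) * F y \<le> \<phi> T - s * (F T - B w \<bullet> T)"
        using sT[OF y(1)] split[of y] by linarith
      then show "f y + h y \<le> (\<phi> T - s * (F T - B w \<bullet> T)) / (1 - s)"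
        using s by (simp add: pos_le_divide_eq mult.commute F_def)
    qed
  qed
  then obtain y where y: "y \<in> Dh" "\<And>z. z \<in> Dh \<Longrightarrow> \<phi> y \<le> \<phi> z"
    using closed_epigraph_attains_inf[OF epi T(1) _ lower] by blast
  have "B (s *\<^sub>R w) \<in> subdiff Dh (\<lambda>y. f y + h y) y"
    using y(2) by (force simp: subdiff_def \<phi>_def B_simps[OF B] algebra_simps)
  then show ?thesis using y(1) by blast
qed

end

section \<open>Linear convergence and iteration count\<close>

theorem theorem4:
  fixes B :: "'a::euclidean_space \<Rightarrow> 'a"
    and f :: "'a \<Rightarrow> real" and Df :: "nat \<Rightarrow> 'a \<Rightarrow> 'a list \<Rightarrow> real"
    and h :: "'a \<Rightarrow> real" and Dh S :: "'a set"
    and p :: nat and L q \<sigma> :: real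
    and x :: "nat \<Rightarrow> 'a" and xstar :: 'a
  assumes B: "selfadj_posdef B"
    and p2: "p \<ge> 2"
    and h: "proper_closed_convex Dh h"
    and S: "open S" "convex S" "Dh \<subseteq> S"
    and fconv: "convex_on S f"
    and fder: "has_derivs f Df p S"
    and L: "0 < L"
    and Lip: "\<forall>y\<in>Dh. \<forall>z\<in>Dh. form_norm B p (\<lambda>us. Df p y us - Df p z us) \<le> L * normB B (y - z)"
    and q: "2 \<le> q" "q \<le> real p + 1"
    and \<sigma>: "\<sigma> > 0"
    and uc: "unif_convex Dh (\<lambda>y. f y + h y) B q \<sigma>"
    and xstar: "xstar \<in> Dh" "\<forall>y\<in>Dh. f xstar + h xstar \<le> f y + h y"
    and x0: "x 0 \<in> Dh"
    and iter: "\<forall>k. is_TH B f Df p Dh h (real p * L) (x k) (x (Suc k))"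
    and Dbdd: "bdd_above {normB B (y - xstar) | y. y \<in> Dh \<and> f y + h y \<le> f (x 0) + h (x 0)}"
  defines "Fs \<equiv> f xstar + h xstar"
    and "D \<equiv> Sup {normB B (y - xstar) | y. y \<in> Dh \<and> f y + h y \<le> f (x 0) + h (x 0)}"
  defines "\<omega> \<equiv> (real p + 1) / fact p * ((q - 1) / q) powr (q - 1) * L * D powr (real p - q + 1) / \<sigma>"
  shows "(\<forall>k\<ge>1. f (x k) + h (x k) - Fs
            \<le> exp (- real k / (1 + \<omega> powr (1 / real p))) * (f (x 0) + h (x 0) - Fs))
       \<and> (\<forall>\<epsilon>>0. f (x (nat (\<lceil>(1 + \<omega> powr (1 / real p)) * ln ((f (x 0) + h (x 0) - Fs) / \<epsilon>)\<rceil> + 1)))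
                 + h (x (nat (\<lceil>(1 + \<omega> powr (1 / real p)) * ln ((f (x 0) + h (x 0) - Fs) / \<epsilon>)\<rceil> + 1))) - Fs \<le> \<epsilon>)"
proof -
  note ctx = B p2 h S fconv fder L Lip
  define W where "W = \<omega> powr (1 / real p)"
  define \<delta> where "\<delta> = (\<lambda>k. f (x k) + h (x k) - Fs)"
  have W: "W \<ge> 0" by (simp add: W_def)
  have xD: "x k \<in> Dh" for k using x0 iter by (cases k) (auto simp: is_TH_def)
  have \<delta>0: "\<delta> k \<ge> 0" for k using xstar(2) xD by (simp add: \<delta>_def Fs_def)
  have step: "\<exists>w. B w \<in> subdiff Dh (\<lambda>y. f y + h y) (x (Suc k)) \<and> 0 \<le> B w \<bullet> (x k - x (Suc k)) \<and>
      normB B w ^ (p + 1) \<le> (real p + 1) / fact p * L * (B w \<bullet> (x k - x (Suc k))) ^ p" for k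
    using tensor_step_progress[OF ctx xD iter[rule_format]] by metis
  have drop: "B w \<bullet> (x k - x (Suc k)) \<le> \<delta> k - \<delta> (Suc k)"
    if "B w \<in> subdiff Dh (\<lambda>y. f y + h y) (x (Suc k))" for w k
    using that xD[of k] by (force simp: subdiff_def \<delta>_def)
  have dec: "\<delta> (Suc k) \<le> \<delta> k" for k
    using step[of k] drop[of _ k] by force
  \<comment> \<open>The values never exceed the initial one, so all iterates stay in the level set
    over which D is taken.\<close>
  have mono: "\<delta> k \<le> \<delta> 0" for k
    by (induction k) (use dec order_trans in blast)+
  have rate: "\<delta> (Suc k) \<le> exp (- 1 / (1 + W)) * \<delta> k" for k
  proof (cases "\<delta> 0 = 0")
    \<comment> \<open>Only in this case can D vanish, and \<open>D powr 0\<close> would then be 0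
      instead of 1. The strict gap in the other case also supplies the boundedness of all sublevel
      sets.\<close>
    case True
    then show ?thesis using mono[of "Suc k"] \<delta>0[of k] by (simp add: order_trans)
  next
    case False
    have Dub: "normB B (y - xstar) \<le> D" if "y \<in> Dh" "f y + h y \<le> f (x 0) + h (x 0)" for y
      unfolding D_def by (rule cSup_upper[OF _ Dbdd]) (use that in blast)
    have gt: "f xstar + h xstar < f (x 0) + h (x 0)"
      using False \<delta>0[of 0] by (simp add: \<delta>_def Fs_def)
    then have "x 0 \<noteq> xstar" by auto
    then have D: "D > 0"
      using Dub[OF x0] normB_nonneg[OF B, of "x 0 - xstar"] normB_eq_0_iff[OF B, of "x 0 - xstar"] by force
    have bounded: "bounded {y \<in> Dh. f y + h y \<le> c}" for c
      by (rule convex_sublevel_bounded[OF B convex_on_F[OF ctx] xstar(1) x0 gt Dub])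
    obtain w where w: "B w \<in> subdiff Dh (\<lambda>y. f y + h y) (x (Suc k))"
      "0 \<le> B w \<bullet> (x k - x (Suc k))"
      "normB B w ^ (p + 1) \<le> (real p + 1) / fact p * L * (B w \<bullet> (x k - x (Suc k))) ^ p"
      using step by blast
    have "\<delta> (Suc k) \<le> ((real p + 1) / fact p * L * ((q - 1) / q) powr (q - 1)
        * D powr (real p - q + 1) / \<sigma>) powr (1 / real p) * (B w \<bullet> (x k - x (Suc k)))"
    proof (rule gap_rate_real[OF p2 q \<sigma> D _ normB_nonneg[OF B] w(2,3)])
      show "0 < (real p + 1) / fact p * L" using L by simp
      have "\<delta> (Suc k) \<le> B w \<bullet> (x (Suc k) - xstar)"
        using w(1) xstar(1) by (force simp: subdiff_def \<delta>_def Fs_def inner_diff_right)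
      also have "\<dots> \<le> normB B w * normB B (x (Suc k) - xstar)" by (rule B_Cauchy_Schwarz[OF B])
      also have "\<dots> \<le> normB B w * D"
        using Dub[OF xD, of "Suc k"] mono[of "Suc k"]
        by (intro mult_left_mono normB_nonneg[OF B]) (simp add: \<delta>_def)
      finally show "\<delta> (Suc k) \<le> normB B w * D" .
      show "\<delta> (Suc k) \<le> (q - 1) / q * (normB B w * (normB B w / \<sigma>) powr (1 / (q - 1)))"
        using unif_convex_gap_bound[OF B uc \<sigma> q(1) xstar(1) xD w(1)
            tilted_minimizer[OF ctx xstar(1) xstar(2)[rule_format] bounded xD w(1)]]
        by (simp add: \<delta>_def Fs_def)
    qed
    also have "\<dots> = W * (B w \<bullet> (x k - x (Suc k)))" by (simp add: W_def \<omega>_def mult_ac)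
    also have "\<dots> \<le> W * (\<delta> k - \<delta> (Suc k))" by (intro mult_left_mono drop w(1) W)
    finally show ?thesis by (rule linear_rate_exp[OF _ W \<delta>0])
  qed
  have main: "\<delta> k \<le> exp (- real k / (1 + W)) * \<delta> 0" for k
  proof (induction k)
    case (Suc k)
    have "\<delta> (Suc k) \<le> exp (- 1 / (1 + W)) * (exp (- real k / (1 + W)) * \<delta> 0)"
      by (rule order_trans[OF rate]) (intro mult_left_mono Suc.IH, simp)
    also have "\<dots> = exp (- 1 / (1 + W) + - real k / (1 + W)) * \<delta> 0"
      by (simp only: exp_add mult.assoc)
    also have "- 1 / (1 + W) + - real k / (1 + W) = - real (Suc k) / (1 + W)"
      by (simp add: diff_divide_distrib)
    finally show ?case .
  qed simp
  have complexity: "\<delta> (nat (\<lceil>(1 + W) * ln (\<delta> 0 / \<epsilon>)\<rceil> + 1)) \<le> \<epsilon>" if \<epsilon>: "\<epsilon> > 0" for \<epsilon>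
  proof (cases "\<delta> 0 \<le> \<epsilon>")
    \<comment> \<open>Here the logarithm is at most 0 (\<open>ln 0\<close> is 0), and
      \<open>nat\<close> may cut the index off at 0, so the argument uses monotonicity of the values
      rather than the rate.\<close>
    case True
    then show ?thesis using mono order_trans by blast
  next
    case False
    define K where "K = nat (\<lceil>(1 + W) * ln (\<delta> 0 / \<epsilon>)\<rceil> + 1)"
    have "(1 + W) * ln (\<delta> 0 / \<epsilon>) \<le> real K" unfolding K_def by linarith
    then have "ln (\<delta> 0 / \<epsilon>) \<le> real K / (1 + W)"
      using W by (simp add: pos_le_divide_eq mult.commute)
    then have "exp (- real K / (1 + W)) \<le> exp (- ln (\<delta> 0 / \<epsilon>))" by simp
    also have "\<dots> = \<epsilon> / \<delta> 0" using False \<epsilon> by (simp add: exp_minus)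
    finally have "exp (- real K / (1 + W)) * \<delta> 0 \<le> \<epsilon>"
      using False \<epsilon> by (simp add: pos_le_divide_eq)
    then show ?thesis using main[of K] by (simp add: K_def)
  qed
  show ?thesis
    using main complexity unfolding \<delta>_def W_def by blast
qed

end
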